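(* Let $g\colon\mathbb{S}^1\to\mathbb{S}^1$ be an orientation-preserving homeomorphism and let $\widetilde Z$, $Q$, $S_Z$ be as in the context. The following are quantitatively equivalent: (1) $g$ is $L$-bi-Lipschitz (with respect to $\sigma$); (2) there exists an $L'$-bi-Lipschitz homeomorphism $\Psi\colon\widetilde Z\to\mathbb{S}^2$; (3) there exists $C'\ge 0$ such that for every $y\in Q(S_Z)$, $$\liminf_{r\to0^+}\frac{\mathcal{H}^2_{\widetilde Z}(\overline{B}_{\widetilde Z}(y,r))}{\pi r^2}\le C'.$$ More precisely: (1) implies (2) with $L'=L$; (2) implies (3) with $C'=(L')^4$; (3) implies (1) with $L=\pi C'$.
   Context: Let $\mathbb{S}^2\subset\mathbb{R}^3$ be the unit sphere with the length (great-circle) distance $\sigma$, let $\mathbb{S}^1=\mathbb{S}^2\cap(\mathbb{R}^2\times\{0\})$ be the equator, and let $Z_1,Z_2$ be the open southern and northern hemispheres, with $(0,0,1)\in Z_2$. Given an orientation-preserving homeomorphism $g\colon\mathbb{S}^1\to\mathbb{S}^1$, let $Z$ be the set obtained from the disjoint union $\overline Z_1\sqcup\overline Z_2$ by identifying each $z\in\mathbb{S}^1\subset\overline Z_1$ with $g(z)\in\mathbb{S}^1\subset\overline Z_2$, with induced maps $\iota_i\colon\overline Z_i\to Z$, and seam $S_Z=\iota_1(\mathbb{S}^1)=\iota_2(\mathbb{S}^1)$. Define $D\colon Z\times Z\to[0,\infty]$ by: $D(x,y)=\infty$ if one of $x,y$ lies in $\iota_1(Z_1)$ and the other in $\iota_2(Z_2)$;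 $D(\iota_1(a),\iota_1(b))=\min\{\sigma(a,b),\sigma(g(a),g(b))\}$ for $a,b\in\mathbb{S}^1$; and otherwise (both points in $\iota_i(\overline Z_i)$ for a common $i$, not both on the seam) $D(x,y)=\sigma(\iota_i^{-1}(x),\iota_i^{-1}(y))$. Let $d_Z(x,y)=\inf\sum_{k=1}^n D(x_k,x_{k+1})$, the infimum over finite chains $x=x_1,\dots,x_{n+1}=y$ in $Z$. $d_Z$ is a pseudodistance; $\widetilde Z$ denotes the metric space obtained by identifying points at $d_Z$-distance zero, $Q\colon Z\to\widetilde Z$ the quotient map, $d_{\widetilde Z}$ the induced distance. $\mathcal{H}^2_{\widetilde Z}$ is the 2-dimensional Hausdorff measure on $\widetilde Z$ (normalized to agree with Lebesgue measure on $\mathbb{R}^2$) and $\overline B_{\widetilde Z}(y,r)$ the closed ball. *)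

theory Defs
  imports "HOL-Analysis.Analysis"
begin

definition S2 :: "(real^3) set" where
  "S2 = sphere 0 1"

definition S1 :: "(real^3) set" where
  "S1 = {p \<in> S2. p$3 = 0}"

definition Zs :: "(real^3) set" where
  "Zs = {p \<in> S2. p$3 < 0}"

definition Zn :: "(real^3) set" where
  "Zn = {p \<in> S2. p$3 > 0}"

definition Zs_closed :: "(real^3) set" where
  "Zs_closed = {p \<in> S2. p$3 \<le> 0}"

definition sigma :: "real^3 \<Rightarrow> real^3 \<Rightarrow> real" where
  "sigma a b = arccos (a \<bullet> b)"

definition circ :: "real \<Rightarrow> real^3" where
  "circ t = vector [cos t, sin t, 0]"

definition orient_pres_homeo :: "(real^3 \<Rightarrow> real^3) \<Rightarrow> bool" where
  "orient_pres_homeo g \<longleftrightarrow>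
     (\<exists>h. homeomorphism S1 S1 g h) \<and>
     (\<exists>G::real \<Rightarrow> real. continuous_on UNIV G \<and> strict_mono G \<and> (\<forall>t. g (circ t) = circ (G t)))"

definition bilip :: "('a \<Rightarrow> 'a \<Rightarrow> real) \<Rightarrow> 'a set \<Rightarrow> ('b \<Rightarrow> 'b \<Rightarrow> real) \<Rightarrow> real \<Rightarrow> ('a \<Rightarrow> 'b) \<Rightarrow> bool" where
  "bilip d X d' L f \<longleftrightarrow> 0 < L \<and>
     (\<forall>x\<in>X. \<forall>y\<in>X. d x y / L \<le> d' (f x) (f y) \<and> d' (f x) (f y) \<le> L * d x y)"

text \<open>Model of Z: the point \<open>(False,p)\<close> is \<open>\<iota>\<^sub>1(p)\<close> for p in the closed southern
  hemisphere; the point \<open>(True,p)\<close> is \<open>\<iota>\<^sub>2(p)\<close> for p in the open northern hemisphere.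
  Seam points are represented through \<open>\<iota>\<^sub>1\<close>, i.e. \<open>\<iota>\<^sub>2(g z) = \<iota>\<^sub>1(z) = (False,z)\<close>.\<close>

definition Zset :: "(bool \<times> (real^3)) set" where
  "Zset = {(False, p) | p. p \<in> Zs_closed} \<union> {(True, p) | p. p \<in> Zn}"

definition iota1 :: "real^3 \<Rightarrow> (bool \<times> (real^3))" where
  "iota1 p = (False, p)"

definition iota2 :: "(real^3 \<Rightarrow> real^3) \<Rightarrow> real^3 \<Rightarrow> (bool \<times> (real^3))" where
  "iota2 g p = (if p \<in> S1 then (False, the_inv_into S1 g p) else (True, p))"

definition seam :: "(bool \<times> (real^3)) set" where
  "seam = iota1 ` S1"

text \<open>The function D (values in [0,\<infinity>]), written out on the representatives:
  \<open>\<infinity>\<close> between \<open>\<iota>\<^sub>1(Z\<^sub>1)\<close> and \<open>\<iota>\<^sub>2(Z\<^sub>2)\<close>; min of the two distances for two seam points;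
  otherwise the sphere distance of the preimages under the common \<open>\<iota>\<^sub>i\<close>
  (for a seam point \<open>\<iota>\<^sub>1(a)\<close>, \<open>\<iota>\<^sub>2\<^sup>-\<^sup>1(\<iota>\<^sub>1 a) = g a\<close>).\<close>
definition DZ :: "(real^3 \<Rightarrow> real^3) \<Rightarrow> (bool \<times> (real^3)) \<Rightarrow> (bool \<times> (real^3)) \<Rightarrow> ennreal" where
  "DZ g x y =
     (case (x, y) of
        ((False, a), (False, b)) \<Rightarrow>
           (if a \<in> S1 \<and> b \<in> S1 then ennreal (min (sigma a b) (sigma (g a) (g b)))
            else ennreal (sigma a b))
      | ((False, a), (True, q)) \<Rightarrow> (if a \<in> S1 then ennreal (sigma (g a) q) else \<infinity>)
      | ((True, p), (False, b)) \<Rightarrow> (if b \<in> S1 then ennreal (sigma p (g b)) else \<infinity>)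
      | ((True, p), (True, q)) \<Rightarrow> ennreal (sigma p q))"

definition dZ :: "(real^3 \<Rightarrow> real^3) \<Rightarrow> (bool \<times> (real^3)) \<Rightarrow> (bool \<times> (real^3)) \<Rightarrow> ennreal" where
  "dZ g x y =
     (INF nc \<in> {(n, c). 0 < n \<and> c 0 = x \<and> c n = y \<and> (\<forall>k\<le>n. c k \<in> Zset)}.
        (\<Sum>k<fst nc. DZ g (snd nc k) (snd nc (Suc k))))"

definition Qmap :: "(real^3 \<Rightarrow> real^3) \<Rightarrow> (bool \<times> (real^3)) \<Rightarrow> (bool \<times> (real^3)) set" where
  "Qmap g x = {y \<in> Zset. dZ g x y = 0}"

definition Ztil :: "(real^3 \<Rightarrow> real^3) \<Rightarrow> (bool \<times> (real^3)) set set" where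
  "Ztil g = Qmap g ` Zset"

text \<open>Induced distance (d_Z is finite on Z, so enn2real loses nothing).\<close>
definition dtil :: "(real^3 \<Rightarrow> real^3) \<Rightarrow> (bool \<times> (real^3)) set \<Rightarrow> (bool \<times> (real^3)) set \<Rightarrow> real" where
  "dtil g P R = enn2real (dZ g (SOME x. x \<in> P) (SOME y. y \<in> R))"

definition cball_til :: "(real^3 \<Rightarrow> real^3) \<Rightarrow> (bool \<times> (real^3)) set \<Rightarrow> real \<Rightarrow> (bool \<times> (real^3)) set set" where
  "cball_til g y r = {z \<in> Ztil g. dtil g y z \<le> r}"

definition diam_d :: "('a \<Rightarrow> 'a \<Rightarrow> real) \<Rightarrow> 'a set \<Rightarrow> ennreal" where
  "diam_d d U = (SUP x\<in>U. SUP y\<in>U. ennreal (d x y))"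

text \<open>Normalised so that it agrees with Lebesgue measure on the plane: weight \<open>\<pi>/4 \<cdot> diam\<^sup>2\<close>.\<close>
definition hausdorff2_delta :: "('a \<Rightarrow> 'a \<Rightarrow> real) \<Rightarrow> 'a set \<Rightarrow> real \<Rightarrow> 'a set \<Rightarrow> ennreal" where
  "hausdorff2_delta d X \<delta> A =
     (INF U \<in> {U :: nat \<Rightarrow> 'a set. A \<subseteq> (\<Union>n. U n) \<and> (\<forall>n. U n \<subseteq> X \<and> diam_d d (U n) \<le> ennreal \<delta>)}.
        (\<Sum>n. ennreal (pi / 4) * diam_d d (U n) ^ 2))"

definition hausdorff2 :: "('a \<Rightarrow> 'a \<Rightarrow> real) \<Rightarrow> 'a set \<Rightarrow> 'a set \<Rightarrow> ennreal" where
  "hausdorff2 d X A = (SUP \<delta>\<in>{0<..}. hausdorff2_delta d X \<delta> A)"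

end

(*
  (1) => (2): extend g to the southern hemisphere by the suspension, which preserves latitudes.
  It has the same bi-Lipschitz constant as g, because the distance of two points of fixed latitudes
  in one hemisphere, divided by the difference of their longitudes, decreases with that difference.
  A geodesic joining the two hemispheres is cut at the equator.

  (2) => (3): a cap of radius R projects orthogonally to a disc of radius at most R with distortion
  tending to 1 as R -> 0, and the disc has an efficient cover by small discs (Vitali).

  (3) => (1): let G be the lift of g to the line. A point of the northern hemisphere at height h over
  the seam parameter v has distance at most |v - t| + h from the seam point t. If G (t + s) - G (t - s)
  >= 2 M s for all small s, then the ball of radius r about t thus contains a northern region of area
  about M r^2, and the isodiametric inequality bounds the density below by M / pi. So M <= pi C'
  whenever this happens, and a Vitali argument turns the increments at arbitrarily small scales into
  G b - G a <= pi C' (b - a). The southern hemisphere gives the same estimate for the inverse of G.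
*)
theory Submission
  imports Defs
begin

section \<open>Area and Hausdorff measure in the plane\<close>

text \<open>The obstacle in (3) => (1) is that the seam may collapse: \<open>D\<close> takes a
  minimum there, so before the bi-Lipschitz bound is known there is no lower bound for
  \<open>dZ\<close> along the seam, and distinct seam points may be identified. What survives is a
  bound off the seam: two points of one hemisphere are at least as far apart as the smaller of their
  spherical distance and the sum of their distances to the equator. Areas are therefore estimated
  only in the part of the ball whose height is at least a small fraction of \<open>r\<close>, and
  only with covering sets of diameter at most that height. The factor pi is a ratio of areas. At
  height h the reachable longitudes fill an interval of length at least 2 M (r - h); integration
  over h gives M r^2, the area of a triangle, to be compared with the area pi r^2 of a disc.
  Moreover, a bound on a lower limit speaks about some small scales only, and \<open>G\<close> is
  not known to be absolutely continuous. This is why the covering argument must work with increments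
  at selected scales and takes place in the image of \<open>G\<close>.\<close>

lemma emeasure_lborel_le_of_dist_le:
  fixes S :: "real set"
  assumes "\<And>x y. x \<in> S \<Longrightarrow> y \<in> S \<Longrightarrow> \<bar>x - y\<bar> \<le> c" "0 \<le> c"
  shows "emeasure lborel S \<le> ennreal c"
proof (cases "S = {}")
  case False
  then obtain x0 where x0: "x0 \<in> S" by auto
  have bb: "bdd_below S" using assms(1)[OF x0] by (intro bdd_belowI[of _ "x0 - c"]) force
  have ba: "bdd_above S" using assms(1)[OF x0] by (intro bdd_aboveI[of _ "x0 + c"]) force
  have "Sup S \<le> Inf S + c"
  proof (rule cSup_least[OF False])
    fix x assume x: "x \<in> S"
    have "x - c \<le> Inf S"
      using assms(1)[OF x] by (intro cInf_greatest[OF False]) force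
    then show "x \<le> Inf S + c" by simp
  qed
  moreover have "S \<subseteq> {Inf S..Sup S}"
    using bb ba by (auto intro: cInf_lower cSup_upper)
  then have "emeasure lborel S \<le> emeasure lborel {Inf S..Sup S}"
    by (intro emeasure_mono) auto
  moreover have "Inf S \<le> Sup S"
    using bb ba x0 by (meson cInf_lower cSup_upper order_trans)
  ultimately show ?thesis by (auto intro: order_trans ennreal_leI)
qed simp

lemma emeasure_cball_plane:
  "0 \<le> r \<Longrightarrow> emeasure lborel (cball (a :: real \<times> real) r) = ennreal (pi * r\<^sup>2)"
  by (simp add: emeasure_cball unit_ball_vol_2 power2_eq_square)

text \<open>Steiner symmetrization in the second coordinate, combined with Cavalieri: with
  \<open>m x\<close> the length of the vertical section, the area is the integral over \<open>y\<close> of the length of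
  \<open>{x. 2 * \<bar>y\<bar> < m x}\<close>, and each of these sets is no longer than the corresponding chord of
  the disc of radius \<open>D / 2\<close>.\<close>
lemma isodiametric_inequality:
  fixes A :: "(real \<times> real) set"
  assumes A: "A \<in> sets borel" and D: "0 \<le> D"
    and diam: "\<And>p q. p \<in> A \<Longrightarrow> q \<in> A \<Longrightarrow> dist p q \<le> D"
  shows "emeasure lborel A \<le> ennreal (pi / 4 * D\<^sup>2)"
proof -
  define m where "m = (\<lambda>x. emeasure lborel (Pair x -` A))"
  have A': "A \<in> sets (lborel \<Otimes>\<^sub>M lborel)" using A by (metis lborel_prod sets_lborel)
  have m_meas [measurable]: "m \<in> borel_measurable borel"
    unfolding m_def using lborel.measurable_emeasure_Pair[OF A'] by simp
  define B where "B = {p :: real \<times> real. ennreal (2 * \<bar>snd p\<bar>) < m (fst p)}"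
  have B [measurable]: "B \<in> sets borel"
  proof -
    have [measurable]: "fst \<in> borel_measurable (borel :: (real \<times> real) measure)"
      "snd \<in> borel_measurable (borel :: (real \<times> real) measure)"
      by (intro borel_measurable_continuous_onI continuous_intros)+
    have "{p \<in> space borel. ennreal (2 * \<bar>snd p\<bar>) < m (fst p)} \<in> sets (borel :: (real \<times> real) measure)"
      by measurable
    then show ?thesis by (simp add: B_def)
  qed
  then have B': "B \<in> sets (lborel \<Otimes>\<^sub>M lborel)" by (metis lborel_prod sets_lborel)
  have diam': "(fst p - fst q)\<^sup>2 + (snd p - snd q)\<^sup>2 \<le> D\<^sup>2" if "p \<in> A" "q \<in> A" for p q
  proof -
    have "(dist p q)\<^sup>2 \<le> D\<^sup>2" using diam[OF that] by (intro power_mono) auto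
    then show ?thesis by (simp add: dist_prod_def dist_real_def)
  qed
  have m_le: "m x \<le> ennreal D" for x
    unfolding m_def
  proof (rule emeasure_lborel_le_of_dist_le[OF _ D])
    fix y z assume "y \<in> Pair x -` A" "z \<in> Pair x -` A"
    then have "dist (x, y) (x, z) \<le> D" by (intro diam) auto
    then show "\<bar>y - z\<bar> \<le> D" by (simp add: dist_prod_def dist_real_def)
  qed
  have secB: "emeasure lborel (Pair x -` B) = m x" for x
  proof -
    obtain c where c: "m x = ennreal c" "0 \<le> c"
      using m_le[of x] by (cases "m x") (auto simp: top_unique)
    have "Pair x -` B = {- c / 2 <..< c / 2}"
      using c by (auto simp: B_def ennreal_less_iff)
    then show ?thesis using c by simp
  qed
  have secB2: "emeasure lborel ((\<lambda>x. (x, y)) -` B) \<le>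
      emeasure lborel ((\<lambda>x. (x, y)) -` cball (0 :: real \<times> real) (D / 2))" for y
  proof -
    have key: "(x - x')\<^sup>2 + 4 * y\<^sup>2 \<le> D\<^sup>2" if xB: "(x, y) \<in> B" and xB': "(x', y) \<in> B" for x x'
    proof -
      have ex: "\<exists>a b. (x, a) \<in> A \<and> (x, b) \<in> A \<and> 2 * \<bar>y\<bar> < b - a" if "(x, y) \<in> B" for x
      proof (rule ccontr)
        assume "\<not> ?thesis"
        then have *: "\<And>a b. (x, a) \<in> A \<Longrightarrow> (x, b) \<in> A \<Longrightarrow> b - a \<le> 2 * \<bar>y\<bar>" by force
        have "m x \<le> ennreal (2 * \<bar>y\<bar>)"
          unfolding m_def
        proof (rule emeasure_lborel_le_of_dist_le)
          fix a b assume "a \<in> Pair x -` A" "b \<in> Pair x -` A"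
          then show "\<bar>a - b\<bar> \<le> 2 * \<bar>y\<bar>" using *[of a b] *[of b a] by auto
        qed simp
        then show False using that by (simp add: B_def)
      qed
      obtain a b where ab: "(x, a) \<in> A" "(x, b) \<in> A" "2 * \<bar>y\<bar> < b - a" using ex[OF xB] by blast
      obtain a' b' where ab': "(x', a') \<in> A" "(x', b') \<in> A" "2 * \<bar>y\<bar> < b' - a'" using ex[OF xB'] by blast
      \<comment> \<open>The heights b - a' and b' - a of the two diagonals add up to more than 4
        |y|, so one of them is at least 2 |y|. As that diagonal has length at most \<open>D\<close>,
        the horizontal offset is bounded by the chord of the disc.\<close>
      have "2 * \<bar>y\<bar> \<le> b - a' \<or> 2 * \<bar>y\<bar> \<le> b' - a" using ab ab' by argo
      then show ?thesis
      proof
        assume "2 * \<bar>y\<bar> \<le> b - a'"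
        then have "(2 * \<bar>y\<bar>)\<^sup>2 \<le> (b - a')\<^sup>2" by (intro power_mono) auto
        then show ?thesis using diam'[OF ab(2) ab'(1)] by (simp add: power_mult_distrib)
      next
        assume "2 * \<bar>y\<bar> \<le> b' - a"
        then have "(2 * \<bar>y\<bar>)\<^sup>2 \<le> (b' - a)\<^sup>2" by (intro power_mono) auto
        then show ?thesis using diam'[OF ab'(2) ab(1)]
          by (simp add: power_mult_distrib power2_commute)
      qed
    qed
    show ?thesis
    proof (cases "(\<lambda>x. (x, y)) -` B = {}")
      case False
      then obtain x0 where "(x0, y) \<in> B" by auto
      from key[OF this this] have yD: "4 * y\<^sup>2 \<le> D\<^sup>2" by simp
      define s where "s = sqrt (D\<^sup>2 / 4 - y\<^sup>2)"
      have s: "0 \<le> s" "s\<^sup>2 = D\<^sup>2 / 4 - y\<^sup>2" using yD by (auto simp: s_def)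
      have "emeasure lborel ((\<lambda>x. (x, y)) -` B) \<le> ennreal (2 * s)"
      proof (rule emeasure_lborel_le_of_dist_le)
        fix x x' assume "x \<in> (\<lambda>x. (x, y)) -` B" "x' \<in> (\<lambda>x. (x, y)) -` B"
        then have "(x - x')\<^sup>2 \<le> (2 * s)\<^sup>2" using key[of x x'] s by (simp add: power_mult_distrib)
        then show "\<bar>x - x'\<bar> \<le> 2 * s" using s(1) by (metis abs_le_square_iff abs_of_nonneg mult_nonneg_nonneg zero_le_numeral)
      qed (use s in auto)
      moreover have "(\<lambda>x. (x, y)) -` cball (0 :: real \<times> real) (D / 2) = {- s..s}"
      proof -
        have "norm (x, y) \<le> D / 2 \<longleftrightarrow> x\<^sup>2 \<le> s\<^sup>2" for x
        proof -
          have "norm (x, y) \<le> D / 2 \<longleftrightarrow> (norm (x, y))\<^sup>2 \<le> (D / 2)\<^sup>2"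
            using D by (simp add: abs_le_square_iff[symmetric])
          then show ?thesis using s by (auto simp: norm_prod_def power_divide)
        qed
        moreover have "x\<^sup>2 \<le> s\<^sup>2 \<longleftrightarrow> - s \<le> x \<and> x \<le> s" for x
          using s(1) by (simp add: abs_le_square_iff[symmetric] abs_le_iff) argo
        ultimately show ?thesis by (auto simp: set_eq_iff mem_cball_0 simp del: mem_cball norm_le_zero_iff)
      qed
      ultimately show ?thesis using s(1) by simp
    qed simp
  qed
  have "emeasure lborel A = (\<integral>\<^sup>+x. m x \<partial>lborel)"
    unfolding m_def lborel_prod[symmetric] by (rule lborel.emeasure_pair_measure_alt[OF A'])
  also have "\<dots> = emeasure (lborel \<Otimes>\<^sub>M lborel) B"
    by (simp add: lborel.emeasure_pair_measure_alt[OF B'] secB)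
  also have "\<dots> = (\<integral>\<^sup>+y. emeasure lborel ((\<lambda>x. (x, y)) -` B) \<partial>lborel)"
    by (rule lborel_pair.emeasure_pair_measure_alt2[OF B'])
  also have "\<dots> \<le> (\<integral>\<^sup>+y. emeasure lborel ((\<lambda>x. (x, y)) -` cball (0 :: real \<times> real) (D / 2)) \<partial>lborel)"
    by (intro nn_integral_mono secB2)
  also have "\<dots> = emeasure (lborel \<Otimes>\<^sub>M lborel) (cball (0 :: real \<times> real) (D / 2))"
    by (rule lborel_pair.emeasure_pair_measure_alt2[symmetric]) (metis borel_closed closed_cball lborel_prod sets_lborel)
  also have "\<dots> = ennreal (pi / 4 * D\<^sup>2)"
    using D by (simp add: lborel_prod emeasure_cball_plane power_divide)
  finally show ?thesis .
qed

section \<open>Two-dimensional Hausdorff measure compared with planar area\<close>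

lemma hausdorff2_delta_le_countable:
  assumes C: "countable C" and sub: "A \<subseteq> (\<Union>i\<in>C. U i)"
    and U: "\<And>i. i \<in> C \<Longrightarrow> U i \<subseteq> X" "\<And>i. i \<in> C \<Longrightarrow> diam_d d (U i) \<le> ennreal \<delta>"
  shows "hausdorff2_delta d X \<delta> A \<le> (\<integral>\<^sup>+i. ennreal (pi / 4) * diam_d d (U i) ^ 2 \<partial>count_space C)"
proof -
  define N where "N = to_nat_on C ` C"
  define V where "V = (\<lambda>n. if n \<in> N then U (inv_into C (to_nat_on C) n) else {})"
  have inj: "inj_on (to_nat_on C) C" using C by (rule inj_on_to_nat_on)
  have inv: "inv_into C (to_nat_on C) (to_nat_on C i) = i" if "i \<in> C" for i
    using inj that by simp
  have N: "inv_into C (to_nat_on C) n \<in> C" if "n \<in> N" for n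
    using that by (simp add: N_def inv_into_into)
  have [simp]: "diam_d d {} = 0" by (simp add: diam_d_def bot_ennreal)
  have "hausdorff2_delta d X \<delta> A \<le> (\<Sum>n. ennreal (pi / 4) * diam_d d (V n) ^ 2)"
    unfolding hausdorff2_delta_def
  proof (rule INF_lower, safe)
    fix x assume "x \<in> A"
    then obtain i where "i \<in> C" "x \<in> U i" using sub by auto
    then have "x \<in> V (to_nat_on C i)" by (auto simp: V_def N_def inv)
    then show "x \<in> (\<Union>n. V n)" by blast
  next
    fix n x assume "x \<in> V n" then show "x \<in> X"
      using U(1) N by (fastforce simp: V_def split: if_splits)
  next
    fix n show "diam_d d (V n) \<le> ennreal \<delta>" using U(2) N by (auto simp: V_def)
  qed
  also have "\<dots> = (\<integral>\<^sup>+n. ennreal (pi / 4) * diam_d d (V n) ^ 2 \<partial>count_space UNIV)"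
    by (simp add: nn_integral_count_space_nat)
  also have "\<dots> = (\<integral>\<^sup>+n. ennreal (pi / 4) * diam_d d (V n) ^ 2 \<partial>count_space N)"
    by (subst (2) nn_integral_count_space_indicator)
       (auto intro!: nn_integral_cong simp: V_def indicator_def)
  also have "\<dots> = (\<integral>\<^sup>+i. ennreal (pi / 4) * diam_d d (V (to_nat_on C i)) ^ 2 \<partial>count_space C)"
    by (rule nn_integral_bij_count_space[symmetric]) (simp add: N_def inj bij_betw_def)
  also have "\<dots> = (\<integral>\<^sup>+i. ennreal (pi / 4) * diam_d d (U i) ^ 2 \<partial>count_space C)"
    by (intro nn_integral_cong) (auto simp: V_def N_def inv)
  finally show ?thesis .
qed

lemma disjoint_discs_area_le:
  fixes a :: "'i \<Rightarrow> real \<times> real"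
  assumes C: "countable C" and r: "\<And>i. i \<in> C \<Longrightarrow> 0 < r i"
    and disj: "pairwise (\<lambda>i j. disjnt (cball (a i) (r i)) (cball (a j) (r j))) C"
    and sub: "\<And>i. i \<in> C \<Longrightarrow> cball (a i) (r i) \<subseteq> U" and U: "U \<in> sets borel"
  shows "(\<integral>\<^sup>+i. ennreal (pi * (r i)\<^sup>2) \<partial>count_space C) \<le> emeasure lborel U"
proof -
  have "(\<integral>\<^sup>+i. ennreal (pi * (r i)\<^sup>2) \<partial>count_space C) =
      (\<integral>\<^sup>+i. emeasure lborel (cball (a i) (r i)) \<partial>count_space C)"
    using r by (intro nn_integral_cong) (auto simp: emeasure_cball_plane less_imp_le)
  also have "\<dots> = emeasure lborel (\<Union>i\<in>C. cball (a i) (r i))"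
    using disj C by (intro emeasure_UN_countable[symmetric])
      (auto simp: disjoint_family_on_def pairwise_def disjnt_def)
  also have "\<dots> \<le> emeasure lborel U"
    using sub U by (intro emeasure_mono) auto
  finally show ?thesis .
qed

text \<open>Vitali's theorem covers almost all of the disc efficiently; the remaining null set is
  covered by the \<open>5r\<close>-covering lemma inside an open set of small area.\<close>
lemma efficient_disc_cover:
  fixes R e \<delta> :: real
  assumes R: "0 \<le> R" and e: "0 < e" and \<delta>: "0 < \<delta>"
  obtains C :: "((real \<times> real) \<times> real) set"
  where "countable C" "cball 0 R \<subseteq> (\<Union>(a, r)\<in>C. cball a r)"
    "\<And>a r. (a, r) \<in> C \<Longrightarrow> 0 < r \<and> r < \<delta>"
    "(\<integral>\<^sup>+i. ennreal (pi * (snd i)\<^sup>2) \<partial>count_space C) \<le> ennreal (pi * R\<^sup>2 + e)"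
proof -
  \<comment> \<open>This radius adds \<open>e / 2\<close> to the area of the disc and leaves a
    margin around it, so that small discs centred on its boundary also fit.\<close>
  define R' where "R' = sqrt (R\<^sup>2 + e / (2 * pi))"
  have R'sq: "R'\<^sup>2 = R\<^sup>2 + e / (2 * pi)" using e by (simp add: R'_def)
  have RR': "R < R'" unfolding R'_def using R e by (intro real_less_rsqrt) auto
  define K where "K = {i :: (real \<times> real) \<times> real. 0 < snd i \<and> snd i < \<delta> \<and> cball (fst i) (snd i) \<subseteq> ball 0 R'}"
  obtain C1 where C1: "countable C1" "C1 \<subseteq> K"
    "pairwise (\<lambda>i j. disjnt (cball (fst i) (snd i)) (cball (fst j) (snd j))) C1"
    and neg: "negligible (cball 0 R - (\<Union>i\<in>C1. cball (fst i) (snd i)))"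
  proof (rule Vitali_covering_theorem_cballs[of K snd "cball (0 :: real \<times> real) R" fst])
    fix x :: "real \<times> real" and d :: real assume x: "x \<in> cball 0 R" and d: "0 < d"
    have nx: "norm x \<le> R" using x by simp
    define s where "s = min (min d \<delta>) (R' - R) / 2"
    have s: "0 < s" "s < d" "s < \<delta>" "s < R' - R" using d \<delta> RR' by (auto simp: s_def)
    have "cball x s \<subseteq> ball 0 R'"
    proof
      fix z assume "z \<in> cball x s"
      then have "norm (z - x) \<le> s" by (simp add: dist_norm norm_minus_commute)
      then have "norm z \<le> norm x + s" by (metis add_left_mono diff_add_cancel norm_triangle_le_diff norm_triangle_sub order_trans)
      then show "z \<in> ball 0 R'" using nx s by simp
    qed
    then show "\<exists>i. i \<in> K \<and> x \<in> cball (fst i) (snd i) \<and> snd i < d"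
      using s by (intro exI[of _ "(x, s)"]) (auto simp: K_def)
  qed (auto simp: K_def)
  define N where "N = cball 0 R - (\<Union>i\<in>C1. cball (fst i) (snd i))"
  have "N \<in> null_sets lebesgue" using neg by (simp add: N_def negligible_iff_null_sets)
  then have N: "N \<in> sets lebesgue" "emeasure lebesgue N = 0" by auto
  \<comment> \<open>Passing to five times the radius multiplies areas by 25, so that the area e / 50
    becomes the second half of the error \<open>e\<close>. For the same reason the radii in
    \<open>K2\<close> are kept below \<delta> / 5.\<close>
  obtain U where U: "open U" "N \<subseteq> U" "emeasure lebesgue (U - N) < ennreal (e / 50)"
    by (rule sets_lebesgue_outer_open[OF N(1), of "e / 50"]) (use e in auto)
  have "emeasure lborel U = emeasure lebesgue U" using U(1) by simp
  also have "\<dots> = emeasure lebesgue ((U - N) \<union> N)"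
    using U(2) by (simp add: Un_absorb2)
  also have "\<dots> \<le> emeasure lebesgue (U - N) + emeasure lebesgue N"
    using U(1) N(1) by (intro emeasure_subadditive) auto
  finally have Usmall: "emeasure lborel U \<le> ennreal (e / 50)" using U(3) N(2) by simp
  define K2 where "K2 = {i :: (real \<times> real) \<times> real. 0 < snd i \<and> snd i < \<delta> / 5 \<and> cball (fst i) (snd i) \<subseteq> U}"
  have "N \<subseteq> (\<Union>i\<in>K2. cball (fst i) (snd i))"
  proof
    fix x assume "x \<in> N"
    then obtain s where "0 < s" "cball x s \<subseteq> U" using U open_contains_cball by blast
    then have "(x, min s (\<delta> / 10)) \<in> K2" using \<delta> by (force simp: K2_def)
    then show "x \<in> (\<Union>i\<in>K2. cball (fst i) (snd i))"
      using \<open>0 < s\<close> \<delta> by (intro UN_I[of "(x, min s (\<delta> / 10))"]) auto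
  qed
  then obtain C2 where C2: "countable C2" "C2 \<subseteq> K2"
    "pairwise (\<lambda>i j. disjnt (cball (fst i) (snd i)) (cball (fst j) (snd j))) C2"
    "N \<subseteq> (\<Union>i\<in>C2. cball (fst i) (5 * snd i))"
    by (rule Vitali_covering_lemma_cballs[where K = K2 and a = fst and r = snd and B = "\<delta> / 5"]) (auto simp: K2_def less_imp_le)
  define \<phi> :: "(real \<times> real) \<times> real \<Rightarrow> (real \<times> real) \<times> real" where "\<phi> = (\<lambda>i. (fst i, 5 * snd i))"
  define C where "C = C1 \<union> \<phi> ` C2"
  have inj: "inj \<phi>" by (auto simp: \<phi>_def inj_def prod_eq_iff)
  have s1: "(\<integral>\<^sup>+i. ennreal (pi * (snd i)\<^sup>2) \<partial>count_space C1) \<le> ennreal (pi * R'\<^sup>2)"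
  proof -
    have "(\<integral>\<^sup>+i. ennreal (pi * (snd i)\<^sup>2) \<partial>count_space C1) \<le> emeasure lborel (cball (0 :: real \<times> real) R')"
    proof (intro disjoint_discs_area_le[where a = fst])
      fix i assume "i \<in> C1"
      then have i: "i \<in> K" using C1 by blast
      show "0 < snd i" using i by (simp add: K_def)
      have "cball (fst i) (snd i) \<subseteq> ball 0 R'" using i by (simp add: K_def)
      then show "cball (fst i) (snd i) \<subseteq> cball 0 R'" using ball_subset_cball by blast
    qed (use C1 in auto)
    then show ?thesis using R RR' by (simp add: emeasure_cball_plane)
  qed
  have s2: "(\<integral>\<^sup>+i. ennreal (pi * (snd i)\<^sup>2) \<partial>count_space (\<phi> ` C2)) \<le> ennreal (e / 2)"
  proof -
    have "(\<integral>\<^sup>+i. ennreal (pi * (snd i)\<^sup>2) \<partial>count_space (\<phi> ` C2)) =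
        (\<integral>\<^sup>+i. ennreal (pi * (snd (\<phi> i))\<^sup>2) \<partial>count_space C2)"
      using inj by (intro nn_integral_bij_count_space[symmetric]) (auto simp: bij_betw_def inj_on_def inj_def)
    also have "\<dots> = (\<integral>\<^sup>+i. ennreal 25 * ennreal (pi * (snd i)\<^sup>2) \<partial>count_space C2)"
      by (intro nn_integral_cong) (simp add: \<phi>_def power_mult_distrib ennreal_mult'[symmetric] del: ennreal_numeral)
    also have "\<dots> = ennreal 25 * (\<integral>\<^sup>+i. ennreal (pi * (snd i)\<^sup>2) \<partial>count_space C2)"
      by (intro nn_integral_cmult) auto
    also have "\<dots> \<le> ennreal 25 * ennreal (e / 50)"
      using C2 U(1)
      by (intro mult_left_mono order_trans[OF disjoint_discs_area_le[where a = fst] Usmall]) (auto simp: K2_def)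
    also have "\<dots> = ennreal (e / 2)" using e by (subst ennreal_mult[symmetric]) auto
    finally show ?thesis .
  qed
  show thesis
  proof
    show "countable C" using C1 C2 by (simp add: C_def)
    show "cball 0 R \<subseteq> (\<Union>(a, r)\<in>C. cball a r)"
    proof
      fix x assume x: "x \<in> cball (0 :: real \<times> real) R"
      show "x \<in> (\<Union>(a, r)\<in>C. cball a r)"
      proof (cases "x \<in> N")
        case True
        then obtain i where "i \<in> C2" "x \<in> cball (fst i) (5 * snd i)" using C2(4) by blast
        then show ?thesis by (intro UN_I[of "\<phi> i"]) (auto simp: C_def \<phi>_def)
      next
        case False
        then obtain i where "i \<in> C1" "x \<in> cball (fst i) (snd i)" using x by (auto simp: N_def)
        then show ?thesis by (intro UN_I[of i]) (auto simp: C_def split_beta)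
      qed
    qed
    show "0 < r \<and> r < \<delta>" if "(a, r) \<in> C" for a r
      using that C1(2) C2(2) by (auto simp: C_def K_def K2_def \<phi>_def)
    have "(\<integral>\<^sup>+i. ennreal (pi * (snd i)\<^sup>2) \<partial>count_space C)
        \<le> (\<integral>\<^sup>+i. ennreal (pi * (snd i)\<^sup>2) * indicator C1 i + ennreal (pi * (snd i)\<^sup>2) * indicator (\<phi> ` C2) i \<partial>count_space UNIV)"
      by (subst nn_integral_count_space_indicator) (auto intro!: nn_integral_mono simp: C_def indicator_def)
    also have "\<dots> = (\<integral>\<^sup>+i. ennreal (pi * (snd i)\<^sup>2) \<partial>count_space C1) + (\<integral>\<^sup>+i. ennreal (pi * (snd i)\<^sup>2) \<partial>count_space (\<phi> ` C2))"
      by (simp add: nn_integral_add nn_integral_count_space_indicator[symmetric])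
    also have "\<dots> \<le> ennreal (pi * R'\<^sup>2) + ennreal (e / 2)"
      using s1 s2 by (rule add_mono)
    also have "\<dots> = ennreal (pi * R\<^sup>2 + e)"
    proof -
      have "pi * R'\<^sup>2 + e / 2 = pi * R\<^sup>2 + e" using R'sq by (simp add: field_simps)
      then show ?thesis using e by (subst ennreal_plus[symmetric]) auto
    qed
    finally show "(\<integral>\<^sup>+i. ennreal (pi * (snd i)\<^sup>2) \<partial>count_space C) \<le> ennreal (pi * R\<^sup>2 + e)" .
  qed
qed

lemma diam_d_le: "(\<And>x y. x \<in> U \<Longrightarrow> y \<in> U \<Longrightarrow> d x y \<le> D) \<Longrightarrow> diam_d d U \<le> ennreal D"
  unfolding diam_d_def by (intro SUP_least ennreal_leI)

text \<open>The cover consists of the preimages under \<open>f\<close> of the discs of an efficient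
  cover. The piece over a disc of radius r has diameter at most 2 c r, hence weight at most (pi / 4)
  (2 c r)^2 = c^2 pi r^2.\<close>

lemma hausdorff2_le_disc:
  fixes f :: "'a \<Rightarrow> real \<times> real"
  assumes B: "B \<subseteq> X" and c: "0 < c" and R: "0 \<le> R"
    and f: "f ` B \<subseteq> cball 0 R"
    and d: "\<And>x y. x \<in> B \<Longrightarrow> y \<in> B \<Longrightarrow> d x y \<le> c * dist (f x) (f y)"
  shows "hausdorff2 d X B \<le> ennreal (c\<^sup>2 * (pi * R\<^sup>2))"
proof -
  have main: "hausdorff2_delta d X \<delta> B \<le> ennreal (c\<^sup>2 * (pi * R\<^sup>2)) + ennreal e" if \<delta>: "0 < \<delta>" and e: "0 < e" for \<delta> e
  proof -
    obtain C :: "((real \<times> real) \<times> real) set" where C: "countable C" "cball 0 R \<subseteq> (\<Union>(a, r)\<in>C. cball a r)"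
      "\<And>a r. (a, r) \<in> C \<Longrightarrow> 0 < r \<and> r < \<delta> / (2 * c)"
      and sum: "(\<integral>\<^sup>+i. ennreal (pi * (snd i)\<^sup>2) \<partial>count_space C) \<le> ennreal (pi * R\<^sup>2 + e / c\<^sup>2)"
      by (rule efficient_disc_cover[OF R, of "e / c\<^sup>2" "\<delta> / (2 * c)"]) (use \<delta> c e in auto)
    define U where "U = (\<lambda>i. {z \<in> B. f z \<in> cball (fst i) (snd i)})"
    have diam: "diam_d d (U i) \<le> ennreal (2 * c * snd i)" for i
    proof (rule diam_d_le)
      fix x y assume xy: "x \<in> U i" "y \<in> U i"
      then have "dist (f x) (f y) \<le> dist (f x) (fst i) + dist (fst i) (f y)" by (intro dist_triangle)
      also have "\<dots> \<le> 2 * snd i" using xy by (auto simp: U_def dist_commute)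
      finally have "c * dist (f x) (f y) \<le> c * (2 * snd i)" using c by simp
      then show "d x y \<le> 2 * c * snd i" using d[of x y] xy by (auto simp: U_def)
    qed
    have r: "0 < snd i" "2 * c * snd i \<le> \<delta>" if "i \<in> C" for i
      using C(3)[of "fst i" "snd i"] that c by (auto simp: field_simps)
    have "hausdorff2_delta d X \<delta> B \<le> (\<integral>\<^sup>+i. ennreal (pi / 4) * diam_d d (U i) ^ 2 \<partial>count_space C)"
    proof (rule hausdorff2_delta_le_countable[OF C(1)])
      show "B \<subseteq> (\<Union>i\<in>C. U i)"
      proof
        fix z assume z: "z \<in> B"
        then have "f z \<in> (\<Union>(a, r)\<in>C. cball a r)" using f C(2) by blast
        then obtain i where "i \<in> C" "f z \<in> cball (fst i) (snd i)" by (auto simp del: mem_cball)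
        then show "z \<in> (\<Union>i\<in>C. U i)" using z by (auto simp: U_def)
      qed
      show "diam_d d (U i) \<le> ennreal \<delta>" if "i \<in> C" for i
        using diam r[OF that] by (meson ennreal_leI order_trans)
    qed (use B in \<open>auto simp: U_def\<close>)
    also have "\<dots> \<le> (\<integral>\<^sup>+i. ennreal (c\<^sup>2) * ennreal (pi * (snd i)\<^sup>2) \<partial>count_space C)"
    proof (rule nn_integral_mono)
      fix i assume "i \<in> space (count_space C)"
      then have i: "0 < snd i" using r by simp
      have "ennreal (pi / 4) * diam_d d (U i) ^ 2 \<le> ennreal (pi / 4) * ennreal (2 * c * snd i) ^ 2"
        by (intro mult_left_mono power_mono diam) auto
      also have "\<dots> = ennreal (c\<^sup>2) * ennreal (pi * (snd i)\<^sup>2)"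
        using i c by (simp add: ennreal_power ennreal_mult[symmetric] power_mult_distrib mult_ac)
      finally show "ennreal (pi / 4) * diam_d d (U i) ^ 2 \<le> ennreal (c\<^sup>2) * ennreal (pi * (snd i)\<^sup>2)" .
    qed
    also have "\<dots> = ennreal (c\<^sup>2) * (\<integral>\<^sup>+i. ennreal (pi * (snd i)\<^sup>2) \<partial>count_space C)"
      by (intro nn_integral_cmult) auto
    also have "\<dots> \<le> ennreal (c\<^sup>2) * ennreal (pi * R\<^sup>2 + e / c\<^sup>2)"
      by (intro mult_left_mono sum) auto
    also have "\<dots> = ennreal (c\<^sup>2 * (pi * R\<^sup>2)) + ennreal e"
      using c e R by (simp add: ennreal_mult[symmetric] ennreal_plus[symmetric] field_simps del: ennreal_plus)
    finally show ?thesis .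
  qed
  show ?thesis
    unfolding hausdorff2_def
  proof (rule SUP_least)
    fix \<delta> :: real assume "\<delta> \<in> {0<..}"
    then show "hausdorff2_delta d X \<delta> B \<le> ennreal (c\<^sup>2 * (pi * R\<^sup>2))"
      using main[of \<delta>] by (simp add: ennreal_le_epsilon)
  qed
qed

text \<open>Each piece of a cover pulls back under \<open>E\<close> to a planar set of diameter at
  most 1 / c times that of the piece, and the isodiametric inequality turns this into area.
  Expansion is asked only at distances up to one fixed \<delta>, which suffices because
  \<open>hausdorff2\<close> is a supremum over the mesh; near a seam that may collapse, no more than
  that is available.\<close>

lemma hausdorff2_ge_area:
  fixes E :: "real \<times> real \<Rightarrow> 'a"
  assumes T: "T \<in> sets borel" and ET: "E ` T \<subseteq> B" and c: "0 < c" and \<delta>: "0 < \<delta>"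
    and E: "\<And>p q. p \<in> T \<Longrightarrow> q \<in> T \<Longrightarrow> d (E p) (E q) \<le> \<delta> \<Longrightarrow> c * dist p q \<le> d (E p) (E q)"
  shows "ennreal (c\<^sup>2) * emeasure lborel T \<le> hausdorff2 d X B"
proof -
  have "ennreal (c\<^sup>2) * emeasure lborel T \<le> hausdorff2_delta d X \<delta> B"
    unfolding hausdorff2_delta_def
  proof (rule INF_greatest)
    fix U :: "nat \<Rightarrow> 'a set"
    assume "U \<in> {U. B \<subseteq> (\<Union>n. U n) \<and> (\<forall>n. U n \<subseteq> X \<and> diam_d d (U n) \<le> ennreal \<delta>)}"
    then have cov: "B \<subseteq> (\<Union>n. U n)" and U: "\<And>n. diam_d d (U n) \<le> ennreal \<delta>"
      by blast+
    \<comment> \<open>The pulled-back pieces may fail to be measurable; their closures are Borel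
      sets with the same bound on distances.\<close>
    define W where "W = (\<lambda>n. {p \<in> T. E p \<in> U n})"
    have W: "ennreal (c\<^sup>2) * emeasure lborel (closure (W n)) \<le> ennreal (pi / 4) * diam_d d (U n) ^ 2" for n
    proof -
      obtain D where D: "diam_d d (U n) = ennreal D" "0 \<le> D" "D \<le> \<delta>"
        using U[of n] \<delta> by (cases "diam_d d (U n)") (auto simp: top_unique)
      have Wd: "dist p q \<le> D / c" if "p \<in> W n" "q \<in> W n" for p q
      proof -
        have "ennreal (d (E p) (E q)) \<le> diam_d d (U n)"
          unfolding diam_d_def using that by (intro SUP_upper2[of "E p"] SUP_upper) (auto simp: W_def)
        then have le: "d (E p) (E q) \<le> D" using D by simp
        then have "c * dist p q \<le> d (E p) (E q)" using that D by (intro E) (auto simp: W_def)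
        then show ?thesis using le c by (simp add: field_simps)
      qed
      have Wc: "dist p q \<le> D / c" if "p \<in> closure (W n)" "q \<in> closure (W n)" for p q
      proof -
        have "W n \<times> W n \<subseteq> {z. dist (fst z) (snd z) \<le> D / c}" using Wd by auto
        moreover have "closed {z :: (real \<times> real) \<times> (real \<times> real). dist (fst z) (snd z) \<le> D / c}"
          by (intro closed_Collect_le continuous_intros)
        ultimately have "closure (W n \<times> W n) \<subseteq> {z. dist (fst z) (snd z) \<le> D / c}"
          by (rule closure_minimal)
        then show ?thesis using that by (auto simp: closure_Times)
      qed
      have "emeasure lborel (closure (W n)) \<le> ennreal (pi / 4 * (D / c)\<^sup>2)"
        using D c Wc by (intro isodiametric_inequality) auto
      then have "ennreal (c\<^sup>2) * emeasure lborel (closure (W n)) \<le> ennreal (c\<^sup>2) * ennreal (pi / 4 * (D / c)\<^sup>2)"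
        by (intro mult_left_mono) auto
      also have "\<dots> = ennreal (pi / 4) * diam_d d (U n) ^ 2"
        using c D by (simp add: ennreal_mult[symmetric] ennreal_power power_divide)
      finally show ?thesis .
    qed
    have "T \<subseteq> (\<Union>n. closure (W n))"
    proof
      fix p assume p: "p \<in> T"
      then obtain n where "E p \<in> U n" using ET cov by blast
      then have "p \<in> W n" using p by (simp add: W_def)
      then show "p \<in> (\<Union>n. closure (W n))" using closure_subset by blast
    qed
    then have "emeasure lborel T \<le> emeasure lborel (\<Union>n. closure (W n))"
      by (intro emeasure_mono) auto
    also have "\<dots> \<le> (\<Sum>n. emeasure lborel (closure (W n)))"
      by (intro emeasure_subadditive_countably) auto
    finally have "ennreal (c\<^sup>2) * emeasure lborel T \<le> ennreal (c\<^sup>2) * (\<Sum>n. emeasure lborel (closure (W n)))"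
      by (intro mult_left_mono) auto
    also have "\<dots> = (\<Sum>n. ennreal (c\<^sup>2) * emeasure lborel (closure (W n)))"
      by simp
    also have "\<dots> \<le> (\<Sum>n. ennreal (pi / 4) * diam_d d (U n) ^ 2)"
      by (intro suminf_le W) auto
    finally show "ennreal (c\<^sup>2) * emeasure lborel T \<le> (\<Sum>n. ennreal (pi / 4) * diam_d d (U n) ^ 2)" .
  qed
  also have "\<dots> \<le> hausdorff2 d X B"
    unfolding hausdorff2_def using \<delta> by (intro SUP_upper) auto
  finally show ?thesis .
qed

section \<open>The sphere\<close>

lemma sin_ge_mult_cos:
  fixes x :: real assumes "0 \<le> x" "x \<le> pi"
  shows "x * cos x \<le> sin x"
proof -
  have "sin 0 - 0 * cos 0 \<le> sin x - x * cos x"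
  proof (rule DERIV_nonneg_imp_nondecreasing[of 0 x "\<lambda>x. sin x - x * cos x"])
    fix u assume u: "0 \<le> u" "u \<le> x"
    have "((\<lambda>x. sin x - x * cos x) has_real_derivative u * sin u) (at u)"
      by (auto intro!: derivative_eq_intros)
    moreover have "0 \<le> u * sin u" using u assms by (intro mult_nonneg_nonneg sin_ge_zero) auto
    ultimately show "\<exists>y. ((\<lambda>x. sin x - x * cos x) has_real_derivative y) (at u) \<and> 0 \<le> y" by blast
  qed (use assms in auto)
  then show ?thesis by simp
qed

lemma sin_squared_ge:
  fixes x w :: real assumes "\<bar>x\<bar> \<le> w" "w \<le> pi / 2"
  shows "x\<^sup>2 * (cos w)\<^sup>2 \<le> (sin x)\<^sup>2"
proof -
  have "0 \<le> cos w" using assms by (intro cos_ge_zero) auto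
  moreover have "cos w \<le> cos \<bar>x\<bar>" using assms by (intro cos_monotone_0_pi_le) auto
  ultimately have "\<bar>x\<bar> * cos w \<le> \<bar>x\<bar> * cos \<bar>x\<bar>" by (intro mult_left_mono) auto
  also have "\<dots> \<le> sin \<bar>x\<bar>" using assms by (intro sin_ge_mult_cos) auto
  finally have "(\<bar>x\<bar> * cos w)\<^sup>2 \<le> (sin \<bar>x\<bar>)\<^sup>2"
    using \<open>0 \<le> cos w\<close> by (intro power_mono) auto
  then show ?thesis by (cases "0 \<le> x") (simp_all add: power_mult_distrib)
qed

text \<open>This says that x cot x decreases on (0, pi / 2], cleared of denominators. Its derivative
  is (sin u cos u - u) / (sin u)^2, and sin u cos u \<le> u.\<close>

lemma x_cot_antimono:
  fixes x y :: real assumes "0 < x" "x \<le> y" "y \<le> pi / 2"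
  shows "y * cos y * sin x \<le> x * cos x * sin y"
proof -
  have "y * cos y / sin y \<le> x * cos x / sin x"
  proof (rule DERIV_nonpos_imp_nonincreasing[of x y "\<lambda>x. x * cos x / sin x"])
    fix u assume "x \<le> u" "u \<le> y"
    then have u: "0 < u" "u \<le> pi / 2" using assms by auto
    then have s: "0 < sin u" by (intro sin_gt_zero) (use pi_gt_zero in linarith)+
    have "((\<lambda>x. x * cos x / sin x) has_real_derivative (sin u * cos u - u) / (sin u)\<^sup>2) (at u)"
      using s by (auto intro!: derivative_eq_intros simp: field_simps power2_eq_square)
        (metis (no_types) add.commute distrib_left mult.right_neutral power2_eq_square sin_cos_squared_add)
    moreover have "sin u * cos u \<le> u"
    proof -
      have "0 \<le> cos u" using u by (intro cos_ge_zero) auto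
      then have "sin u * cos u \<le> sin u * 1" using s by (intro mult_left_mono) auto
      then show ?thesis using sin_x_le_x[of u] u by simp
    qed
    then have "(sin u * cos u - u) / (sin u)\<^sup>2 \<le> 0" by (simp add: divide_nonpos_nonneg)
    ultimately show "\<exists>z. ((\<lambda>x. x * cos x / sin x) has_real_derivative z) (at u) \<and> z \<le> 0" by blast
  qed fact
  moreover have "0 < sin x" "0 < sin y"
    using assms pi_gt_zero by (auto intro!: sin_gt_zero) 
  ultimately show ?thesis by (simp add: field_simps)
qed

text \<open>Since x sin x / (1 - cos x) = x cot (x / 2), this is the monotonicity of x cot x at half
  angles.\<close>

lemma x_sin_antimono:
  fixes x y :: real assumes "0 < x" "x \<le> y" "y \<le> pi"
  shows "y * sin y * (1 - cos x) \<le> x * sin x * (1 - cos y)"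
proof -
  have h: "sin z = 2 * sin (z / 2) * cos (z / 2)" "1 - cos z = 2 * (sin (z / 2))\<^sup>2" for z :: real
    using sin_double[of "z / 2"] cos_double_sin[of "z / 2"] by auto
  have "y / 2 * cos (y / 2) * sin (x / 2) \<le> x / 2 * cos (x / 2) * sin (y / 2)"
    using assms by (intro x_cot_antimono) auto
  moreover have "0 \<le> sin (x / 2)" "0 \<le> sin (y / 2)" using assms by (auto intro!: sin_ge_zero)
  ultimately have "8 * (sin (x / 2) * sin (y / 2)) * (y / 2 * cos (y / 2) * sin (x / 2)) \<le>
      8 * (sin (x / 2) * sin (y / 2)) * (x / 2 * cos (x / 2) * sin (y / 2))"
    by (intro mult_left_mono) auto
  then show ?thesis unfolding h[of x] h[of y] by (simp add: power2_eq_square algebra_simps)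
qed

text \<open>With \<open>k = sin \<phi> sin \<psi>\<close> and \<open>c = cos \<phi> cos \<psi>\<close>, \<open>arccos (k + c * cos x)\<close> is the distance between
  points of latitudes \<open>\<phi>\<close>, \<open>\<psi>\<close> in one hemisphere whose longitudes differ by \<open>x\<close>.\<close>
lemma arccos_ratio_antimono:
  fixes c k x y :: real
  assumes c: "0 \<le> c" and k: "0 \<le> k" and ck: "c + k \<le> 1" and x: "0 < x" and xy: "x \<le> y" and y: "y \<le> pi"
  shows "arccos (k + c * cos y) * x \<le> arccos (k + c * cos x) * y"
proof (cases "c = 0")
  case True
  have "0 \<le> arccos k" using True k ck by (intro arccos_lbound) auto
  then show ?thesis using True xy by (simp add: mult_left_mono)
next
  case False
  then have c0: "0 < c" using c by simp
  define S where "S = (\<lambda>t. arccos (k + c * cos t))"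
  have rng: "-1 \<le> k + c * cos t" "k + c * cos t \<le> 1" for t
  proof -
    have "c * (-1) \<le> c * cos t" "c * cos t \<le> c * 1" using c by (intro mult_left_mono; simp)+
    then show "-1 \<le> k + c * cos t" "k + c * cos t \<le> 1" using k ck by linarith+
  qed
  have "S y / y \<le> S x / x"
  proof (rule DERIV_nonpos_imp_decreasing_open[OF xy])
    show "continuous_on {x..y} (\<lambda>t. S t / t)"
      unfolding S_def using x rng by (intro continuous_intros) auto
  next
    fix t assume t': "x < t" "t < y"
    then have t: "0 < t" "t < pi" using x y by auto
    define u where "u = k + c * cos t"
    have ct: "cos t < 1" "-1 < cos t"
      using t cos_monotone_0_pi[of 0 t] cos_monotone_0_pi[of t pi] by auto
    have "c * (-1) < c * cos t" "c * cos t < c * 1" using c0 ct by (intro mult_strict_left_mono; simp)+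
    then have u: "-1 < u" "u < 1" using k ck by (auto simp: u_def)
    have St: "S t = arccos u" by (simp add: S_def u_def)
    have sinS: "sin (S t) = sqrt (1 - u\<^sup>2)" using u by (simp add: St sin_arccos_nonzero sin_arccos)
    have u2: "u\<^sup>2 < 1" using u by (simp add: abs_square_less_1 abs_less_iff)
    then have sp: "0 < sin (S t)" by (simp add: sinS)
    have S0: "0 < S t" "S t \<le> pi" using u arccos_lt_bounded[of u] by (auto simp: St)
    have deriv: "((\<lambda>t. S t / t) has_real_derivative (c * sin t / sin (S t) * t - S t) / t\<^sup>2) (at t)"
    proof -
      have "(arccos has_real_derivative inverse (- sqrt (1 - u\<^sup>2))) (at (k + c * cos t))"
        using DERIV_arccos[OF u] by (simp add: u_def)
      moreover have "((\<lambda>t. k + c * cos t) has_real_derivative c * - sin t) (at t)"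
        by (auto intro!: derivative_eq_intros)
      ultimately have "(S has_real_derivative inverse (- sqrt (1 - u\<^sup>2)) * (c * - sin t)) (at t)"
        unfolding S_def by (rule DERIV_chain2)
      then have "(S has_real_derivative c * sin t / sin (S t)) (at t)"
        unfolding sinS by (simp add: divide_inverse mult.commute)
      from DERIV_divide[OF this DERIV_ident] show ?thesis using t by (simp add: power2_eq_square)
    qed
    \<comment> \<open>This is the sign of the derivative. If t \<le> S t, then c sin t \<le> sin (S
      t) is enough, and it holds because u^2 + (c sin t)^2 \<le> (k + c)^2 \<le> 1. Otherwise S t <
      t, and c (1 - cos t) \<le> 1 - cos (S t) combines with the decrease of x sin x / (1 - cos
      x).\<close>
    have "c * sin t * t \<le> S t * sin (S t)"
    proof (cases "t \<le> S t")
      case True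
      have "(c * sin t)\<^sup>2 \<le> 1 - u\<^sup>2"
      proof -
        have "k * c * cos t \<le> k * c * 1" using k c by (intro mult_left_mono) auto
        then have "u\<^sup>2 + (c * sin t)\<^sup>2 \<le> (k + c)\<^sup>2"
        proof -
          have "u\<^sup>2 + (c * sin t)\<^sup>2 = k\<^sup>2 + 2 * (k * c * cos t) + c\<^sup>2"
            by (simp add: u_def power2_sum power_mult_distrib sin_squared_eq algebra_simps)
          then show ?thesis using \<open>k * c * cos t \<le> k * c * 1\<close> by (simp add: power2_sum)
        qed
        also have "\<dots> \<le> 1\<^sup>2" using k c ck by (intro power_mono) auto
        finally show ?thesis by simp
      qed
      then have "c * sin t \<le> sin (S t)" unfolding sinS by (rule real_le_rsqrt)
      then have "c * sin t * t \<le> sin (S t) * t" using t by (intro mult_right_mono) auto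
      also have "\<dots> \<le> sin (S t) * S t" using True sp by (intro mult_left_mono) auto
      finally show ?thesis by (simp add: mult.commute)
    next
      case False
      have st: "0 \<le> sin t" using t by (intro sin_ge_zero) auto
      have cosS: "cos (S t) = u" using u by (simp add: St)
      have "c * (1 - cos t) \<le> 1 - cos (S t)" using ck unfolding cosS u_def by (simp add: algebra_simps)
      then have "t * sin t * (c * (1 - cos t)) \<le> t * sin t * (1 - cos (S t))"
        using t st by (intro mult_left_mono) auto
      also have "\<dots> \<le> S t * sin (S t) * (1 - cos t)"
        using S0 False t by (intro x_sin_antimono) auto
      finally have "(c * sin t * t) * (1 - cos t) \<le> (S t * sin (S t)) * (1 - cos t)"
        by (simp add: mult_ac)
      then show ?thesis using ct by simp
    qed
    then have "c * sin t / sin (S t) * t \<le> S t" using sp by (simp add: field_simps)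
    then have "(c * sin t / sin (S t) * t - S t) / t\<^sup>2 \<le> 0" by (simp add: divide_nonpos_nonneg)
    then show "\<exists>z. ((\<lambda>t. S t / t) has_real_derivative z) (at t) \<and> z \<le> 0" using deriv by blast
  qed
  then show ?thesis using x xy by (simp add: S_def field_simps)
qed

text \<open>For y \<le> x the distance does not grow, and 1 \<le> L suffices; for y > x the
  decreasing ratio bounds the growth by the factor y / x, which is at most L.\<close>

lemma arccos_stretch:
  fixes c k x y :: real
  assumes c: "0 \<le> c" and k: "0 \<le> k" and ck: "c + k \<le> 1" and x: "0 \<le> x" "x \<le> pi" and y: "0 \<le> y" "y \<le> pi"
    and L: "1 \<le> L" and yx: "y \<le> L * x"
  shows "arccos (k + c * cos y) \<le> L * arccos (k + c * cos x)"
proof -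
  have rng: "-1 \<le> k + c * cos t \<and> k + c * cos t \<le> 1" for t
  proof -
    have "c * (-1) \<le> c * cos t" "c * cos t \<le> c * 1" using c by (intro mult_left_mono; simp)+
    then show ?thesis using k ck by linarith
  qed
  have nn: "0 \<le> arccos (k + c * cos t)" for t using rng by (simp add: arccos_lbound)
  show ?thesis
  proof (cases "y \<le> x")
    case True
    have "cos x \<le> cos y" using True x y by (intro cos_monotone_0_pi_le) auto
    then have "arccos (k + c * cos y) \<le> arccos (k + c * cos x)"
      using rng c by (intro arccos_le_arccos) (auto intro: mult_left_mono)
    also have "\<dots> \<le> L * arccos (k + c * cos x)" using nn[of x] L by (simp add: mult_le_cancel_right1)
    finally show ?thesis .
  next
    case False
    then have x0: "0 < x" using yx x y by (cases "x = 0") auto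
    have "arccos (k + c * cos y) * x \<le> arccos (k + c * cos x) * y"
      using x0 False y by (intro arccos_ratio_antimono c k ck) auto
    also have "\<dots> \<le> arccos (k + c * cos x) * (L * x)" using nn yx by (intro mult_left_mono)
    finally have "arccos (k + c * cos y) * x \<le> (L * arccos (k + c * cos x)) * x" by (simp add: mult_ac)
    then show ?thesis using x0 by simp
  qed
qed

section \<open>Great-circle distance on the unit sphere\<close>

lemma inner_real3: "(x :: real^3) \<bullet> y = x$1 * y$1 + x$2 * y$2 + x$3 * y$3"
  by (simp add: inner_vec_def sum_3)

lemma S2_iff: "p \<in> S2 \<longleftrightarrow> p \<bullet> p = 1"
  by (simp add: S2_def norm_eq_1)

lemma S2_norm: "p \<in> S2 \<Longrightarrow> norm p = 1"
  by (simp add: S2_def)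

lemma S1_subset_S2: "S1 \<subseteq> S2"
  by (auto simp: S1_def)

lemma S2_inner_bounds:
  assumes "p \<in> S2" "q \<in> S2" shows "-1 \<le> p \<bullet> q" "p \<bullet> q \<le> 1"
  using Cauchy_Schwarz_ineq2[of p q] assms by (auto simp: S2_norm)

lemma cos_sigma [simp]: "p \<in> S2 \<Longrightarrow> q \<in> S2 \<Longrightarrow> cos (sigma p q) = p \<bullet> q"
  unfolding sigma_def by (intro cos_arccos S2_inner_bounds)

lemma sigma_nonneg: "p \<in> S2 \<Longrightarrow> q \<in> S2 \<Longrightarrow> 0 \<le> sigma p q"
  unfolding sigma_def by (intro arccos_lbound S2_inner_bounds)

lemma sigma_le_pi: "p \<in> S2 \<Longrightarrow> q \<in> S2 \<Longrightarrow> sigma p q \<le> pi"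
  unfolding sigma_def by (intro arccos_ubound S2_inner_bounds)

lemma sigma_commute: "sigma p q = sigma q p"
  by (simp add: sigma_def inner_commute)

lemma sigma_self [simp]: "p \<in> S2 \<Longrightarrow> sigma p p = 0"
  by (simp add: sigma_def S2_iff)

lemma sigma_eq_0D:
  assumes "p \<in> S2" "q \<in> S2" "sigma p q = 0" shows "p = q"
proof -
  have "p \<bullet> q = 1" using cos_sigma[OF assms(1,2)] assms(3) by simp
  then have "(p - q) \<bullet> (p - q) = 0" using assms by (simp add: S2_iff inner_diff inner_commute)
  then show ?thesis by simp
qed

lemma sigma_leI:
  assumes "p \<in> S2" "q \<in> S2" "0 \<le> s" "s \<le> pi \<Longrightarrow> cos s \<le> p \<bullet> q"
  shows "sigma p q \<le> s"
proof (cases "s \<le> pi")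
  case True
  then show ?thesis
    using assms cos_mono_le_eq[of s "sigma p q"] by (simp add: sigma_nonneg sigma_le_pi)
qed (use sigma_le_pi[OF assms(1,2)] in auto)

lemma sin_sigma_sq: "p \<in> S2 \<Longrightarrow> q \<in> S2 \<Longrightarrow> (sin (sigma p q))\<^sup>2 = 1 - (p \<bullet> q)\<^sup>2"
  by (simp add: sin_squared_eq)

lemma sin_sigma_nonneg: "p \<in> S2 \<Longrightarrow> q \<in> S2 \<Longrightarrow> 0 \<le> sin (sigma p q)"
  by (intro sin_ge_zero sigma_nonneg sigma_le_pi)

text \<open>Removing the components along \<open>b\<close> from \<open>a\<close> and
  \<open>c\<close> leaves vectors of norms sin (sigma a b) and sin (sigma b c). Cauchy-Schwarz for
  these two vectors is the inequality cos (sigma a b + sigma b c) \<le> a \<bullet> c.\<close>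

lemma sigma_triangle:
  assumes "a \<in> S2" "b \<in> S2" "c \<in> S2"
  shows "sigma a c \<le> sigma a b + sigma b c"
proof (rule sigma_leI)
  define u where "u = a - (a \<bullet> b) *\<^sub>R b"
  define v where "v = c - (b \<bullet> c) *\<^sub>R b"
  have bb: "b \<bullet> b = 1" "a \<bullet> a = 1" "c \<bullet> c = 1" using assms by (simp_all add: S2_iff)
  have "u \<bullet> u = 1 - (a \<bullet> b)\<^sup>2" "v \<bullet> v = 1 - (b \<bullet> c)\<^sup>2" and uv: "a \<bullet> c = (a \<bullet> b) * (b \<bullet> c) + u \<bullet> v"
    using bb by (auto simp: u_def v_def inner_diff inner_commute power2_eq_square algebra_simps)
  then have n: "norm u = sin (sigma a b)" "norm v = sin (sigma b c)"
    using assms sin_sigma_sq sin_sigma_nonneg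
    by (metis norm_eq_sqrt_inner real_sqrt_unique)+
  have "- (norm u * norm v) \<le> u \<bullet> v" using Cauchy_Schwarz_ineq2[of u v] by linarith
  then show "cos (sigma a b + sigma b c) \<le> a \<bullet> c"
    using assms by (simp add: cos_add uv n)
qed (use assms in \<open>auto intro!: add_nonneg_nonneg sigma_nonneg\<close>)

text \<open>A unit vector in the cone spanned by \<open>p\<close> and \<open>q\<close> lies on a
  shortest arc between them. The sines of the two partial distances are \<beta> and \<alpha> times
  the sine of the full distance, so the addition theorem shows that the sum and the full distance
  have equal cosines.\<close>

lemma sigma_between:
  assumes p: "p \<in> S2" and q: "q \<in> S2" and m: "m = \<alpha> *\<^sub>R p + \<beta> *\<^sub>R q" "m \<in> S2" and "0 \<le> \<alpha>" "0 \<le> \<beta>"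
  shows "sigma p m + sigma m q = sigma p q"
proof -
  define c where "c = p \<bullet> q"
  have pp: "p \<bullet> p = 1" "q \<bullet> q = 1" using p q by (simp_all add: S2_iff)
  have pm: "p \<bullet> m = \<alpha> + \<beta> * c" and mq: "m \<bullet> q = \<alpha> * c + \<beta>"
    using pp by (simp_all add: m(1) inner_add c_def inner_commute)
  have "m \<bullet> m = 1" using m(2) by (simp add: S2_iff)
  then have mm: "\<alpha>\<^sup>2 + \<beta>\<^sup>2 + 2 * \<alpha> * \<beta> * c = 1"
    using pp by (simp add: m(1) inner_add c_def inner_commute power2_eq_square algebra_simps)
  have c1: "-1 \<le> c" "c \<le> 1" using S2_inner_bounds[OF p q] by (simp_all add: c_def)
  have c2: "0 \<le> 1 - c\<^sup>2" using c1 by (simp add: abs_square_le_1 abs_le_iff)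
  have s1: "sin (sigma p m) = \<beta> * sqrt (1 - c\<^sup>2)"
  proof -
    have "(sin (sigma p m))\<^sup>2 = (\<beta> * sqrt (1 - c\<^sup>2))\<^sup>2"
      using mm c2 by (simp add: sin_sigma_sq[OF p m(2)] pm power_mult_distrib) (simp add: power2_eq_square algebra_simps)
    then show ?thesis
      by (rule power2_eq_imp_eq[OF _ sin_sigma_nonneg[OF p m(2)] mult_nonneg_nonneg[OF \<open>0 \<le> \<beta>\<close> real_sqrt_ge_zero[OF c2]]])
  qed
  have s2: "sin (sigma m q) = \<alpha> * sqrt (1 - c\<^sup>2)"
  proof -
    have "(sin (sigma m q))\<^sup>2 = (\<alpha> * sqrt (1 - c\<^sup>2))\<^sup>2"
      using mm c2 by (simp add: sin_sigma_sq[OF m(2) q] mq power_mult_distrib) (simp add: power2_eq_square algebra_simps)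
    then show ?thesis
      by (rule power2_eq_imp_eq[OF _ sin_sigma_nonneg[OF m(2) q] mult_nonneg_nonneg[OF \<open>0 \<le> \<alpha>\<close> real_sqrt_ge_zero[OF c2]]])
  qed
  have "cos (sigma p m + sigma m q) = (\<alpha> + \<beta> * c) * (\<alpha> * c + \<beta>) - \<alpha> * \<beta> * (sqrt (1 - c\<^sup>2))\<^sup>2"
    using p q m(2) by (simp add: cos_add pm mq s1 s2 power2_eq_square)
  also have "\<dots> = c * (\<alpha>\<^sup>2 + \<beta>\<^sup>2 + 2 * \<alpha> * \<beta> * c)"
    using c2 by (simp add: power2_eq_square algebra_simps)
  also have "\<dots> = cos (sigma p q)" unfolding mm using p q by (simp add: c_def)
  finally have eq: "cos (sigma p m + sigma m q) = cos (sigma p q)" .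
  \<comment> \<open>Equal cosines determine an angle only within [0, pi]. The product is cos (sigma
    p m) + cos (sigma m q), and its nonnegativity shows that the two distances add up to at most
    pi.\<close>
  have "0 \<le> (\<alpha> + \<beta>) * (1 + c)" using assms c1 by (intro mult_nonneg_nonneg) auto
  then have "cos (pi - sigma m q) \<le> cos (sigma p m)" using p q m(2) by (simp add: pm mq algebra_simps)
  then have "sigma p m \<le> pi - sigma m q"
    using p q m(2) cos_mono_le_eq[of "pi - sigma m q" "sigma p m"] by (simp add: sigma_nonneg sigma_le_pi)
  then show ?thesis
    using sigma_nonneg[OF p m(2)] sigma_nonneg[OF m(2) q] sigma_nonneg[OF p q] sigma_le_pi[OF p q]
    by (intro cos_inj_pi[OF _ _ _ _ eq]) linarith+
qed

section \<open>The equator, latitude and longitude\<close>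

lemma circ_nth [simp]: "circ t $ 1 = cos t" "circ t $ 2 = sin t" "circ t $ 3 = 0"
  by (simp_all add: circ_def vector_3)

lemma inner_circ: "circ s \<bullet> circ t = cos (s - t)"
  by (simp add: inner_real3 cos_diff)

lemma circ_in_S1 [simp]: "circ t \<in> S1"
  by (simp add: S1_def S2_iff inner_circ)

lemma circ_in_S2 [simp]: "circ t \<in> S2"
  using S1_subset_S2 circ_in_S1 by blast

lemma circ_eq_iff: "circ s = circ t \<longleftrightarrow> cos s = cos t \<and> sin s = sin t"
  by (auto simp: vec_eq_iff forall_3)

lemma S1_circE:
  assumes "p \<in> S1" obtains t where "p = circ t"
proof -
  have "(p$1)\<^sup>2 + (p$2)\<^sup>2 = 1" using assms by (auto simp: S1_def S2_iff inner_real3 power2_eq_square)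
  then obtain t where "p$1 = cos t" "p$2 = sin t" by (rule sincos_total_2pi)
  then have "p = circ t" using assms by (auto simp: vec_eq_iff forall_3 S1_def)
  then show ?thesis by (rule that)
qed

lemma sigma_circ_le: "sigma (circ s) (circ t) \<le> \<bar>s - t\<bar>"
  by (rule sigma_leI) (auto simp: inner_circ)

lemma sigma_circ_eq: "\<bar>s - t\<bar> \<le> pi \<Longrightarrow> sigma (circ s) (circ t) = \<bar>s - t\<bar>"
  unfolding sigma_def inner_circ using arccos_cos[of "\<bar>s - t\<bar>"] by simp

lemma S1_circ_pairE:
  assumes "p \<in> S1" "q \<in> S1"
  obtains s t where "p = circ s" "q = circ t" "\<bar>s - t\<bar> = sigma p q"
proof -
  obtain s where s: "p = circ s" using assms(1) by (rule S1_circE)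
  obtain t0 where t0: "q = circ t0" using assms(2) by (rule S1_circE)
  \<comment> \<open>Rounding (s - t0) / (2 pi) to a nearest integer brings \<open>t\<close> to
    within pi of \<open>s\<close>, where the difference of the parameters is the distance.\<close>
  define k where "k = \<lfloor>(s - t0 + pi) / (2 * pi)\<rfloor>"
  define t where "t = t0 + 2 * pi * of_int k"
  have "cos t = cos t0" "sin t = sin t0"
    using sin_cos_eq_iff[of t t0] by (auto simp: t_def)
  then have "q = circ t" by (simp add: t0 circ_eq_iff)
  moreover have "of_int k \<le> (s - t0 + pi) / (2 * pi)" "(s - t0 + pi) / (2 * pi) < of_int k + 1"
    unfolding k_def by linarith+
  then have "\<bar>s - t\<bar> \<le> pi" by (auto simp: t_def field_simps abs_le_iff)
  ultimately show ?thesis using s sigma_circ_eq that by metis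
qed

text \<open>For \<open>a\<close> on the equator this is the point of latitude \<phi> on the meridian
  through \<open>a\<close>. At latitudes pi / 2 and - pi / 2 it is a pole, whatever \<open>a\<close>
  is.\<close>

definition lift :: "real^3 \<Rightarrow> real \<Rightarrow> real^3" where
  "lift a \<phi> = cos \<phi> *\<^sub>R a + sin \<phi> *\<^sub>R axis 3 1"

lemma lift_0 [simp]: "lift a 0 = a"
  by (simp add: lift_def)

lemma lift_nth_3: "a \<in> S1 \<Longrightarrow> lift a \<phi> $ 3 = sin \<phi>"
  by (simp add: lift_def S1_def)

lemma inner_lift:
  "a \<in> S1 \<Longrightarrow> b \<in> S1 \<Longrightarrow> lift a \<phi> \<bullet> lift b \<psi> = sin \<phi> * sin \<psi> + cos \<phi> * cos \<psi> * (a \<bullet> b)"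
  by (simp add: lift_def inner_real3 S1_def axis_def algebra_simps)

lemma lift_in_S2 [simp]:
  assumes "a \<in> S1" shows "lift a \<phi> \<in> S2"
proof -
  have "a \<bullet> a = 1" using assms by (simp add: S1_def S2_iff)
  then show ?thesis
    using sin_cos_squared_add[of \<phi>] by (simp add: S2_iff inner_lift[OF assms assms] power2_eq_square)
qed

lemma sigma_lift_same:
  assumes "a \<in> S1" "\<bar>\<phi> - \<psi>\<bar> \<le> pi"
  shows "sigma (lift a \<phi>) (lift a \<psi>) = \<bar>\<phi> - \<psi>\<bar>"
proof -
  have "a \<bullet> a = 1" using assms by (simp add: S1_def S2_iff)
  then have "lift a \<phi> \<bullet> lift a \<psi> = cos \<bar>\<phi> - \<psi>\<bar>"
    using assms by (simp add: inner_lift cos_diff)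
  then show ?thesis using assms arccos_cos[of "\<bar>\<phi> - \<psi>\<bar>"] by (simp add: sigma_def)
qed

lemma S2_liftE:
  assumes "p \<in> S2"
  obtains a \<phi> where "a \<in> S1" "-(pi / 2) \<le> \<phi>" "\<phi> \<le> pi / 2" "p = lift a \<phi>"
proof -
  have n: "(p$1)\<^sup>2 + (p$2)\<^sup>2 + (p$3)\<^sup>2 = 1" using assms by (simp add: S2_iff inner_real3 power2_eq_square)
  then have "(p$3)\<^sup>2 \<le> 1" by (smt (verit) zero_le_power2)
  then have p3: "-1 \<le> p$3" "p$3 \<le> 1" by (auto simp: abs_square_le_1 abs_le_iff)
  define \<phi> where "\<phi> = arcsin (p$3)"
  have \<phi>: "-(pi / 2) \<le> \<phi>" "\<phi> \<le> pi / 2" "sin \<phi> = p$3"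
    using p3 arcsin_bounded[of "p$3"] by (auto simp: \<phi>_def)
  have c2: "(cos \<phi>)\<^sup>2 = (p$1)\<^sup>2 + (p$2)\<^sup>2" using n \<phi>(3) by (simp add: cos_squared_eq)
  show ?thesis
  proof (cases "cos \<phi> = 0")
    case True
    then have "(p$1)\<^sup>2 + (p$2)\<^sup>2 = 0" using c2 by simp
    then have "p$1 = 0" "p$2 = 0" by (auto simp: sum_power2_eq_zero_iff)
    then have "p = lift (circ 0) \<phi>"
      using True \<phi> by (auto simp: vec_eq_iff forall_3 lift_def axis_def)
    then show ?thesis using \<phi> by (intro that[of "circ 0" \<phi>]) auto
  next
    case False
    have "(p$1 / cos \<phi>)\<^sup>2 + (p$2 / cos \<phi>)\<^sup>2 = 1"
      using False by (simp add: power_divide add_divide_distrib[symmetric] c2[symmetric])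
    then obtain t where t: "p$1 / cos \<phi> = cos t" "p$2 / cos \<phi> = sin t" by (rule sincos_total_2pi)
    then have "p = lift (circ t) \<phi>"
      using False \<phi> by (auto simp: vec_eq_iff forall_3 lift_def axis_def field_simps)
    then show ?thesis using \<phi> by (intro that[of "circ t" \<phi>]) auto
  qed
qed

definition lat :: "real^3 \<Rightarrow> real" where
  "lat p = arcsin (p$3)"

lemma lat_S1 [simp]: "a \<in> S1 \<Longrightarrow> lat a = 0"
  by (simp add: lat_def S1_def)

lemma lat_lift: "a \<in> S1 \<Longrightarrow> -(pi / 2) \<le> \<phi> \<Longrightarrow> \<phi> \<le> pi / 2 \<Longrightarrow> lat (lift a \<phi>) = \<phi>"
  by (simp add: lat_def lift_nth_3 arcsin_sin)

text \<open>The latitude is \<open>pi / 2\<close> minus the distance to the north pole.\<close>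
lemma lat_lipschitz:
  assumes "p \<in> S2" "q \<in> S2" shows "\<bar>lat p - lat q\<bar> \<le> sigma p q"
proof -
  define n :: "real^3" where "n = axis 3 1"
  have n: "n \<in> S2" by (simp add: n_def S2_def norm_axis_1)
  have "lat p = pi / 2 - sigma n p" if "p \<in> S2" for p
  proof -
    have "n \<bullet> p = p$3" by (simp add: n_def inner_axis')
    then show ?thesis using S2_inner_bounds[OF n that]
      by (simp add: lat_def sigma_def arcsin_arccos_eq)
  qed
  then show ?thesis
    using assms n sigma_triangle[of n p q] sigma_triangle[of n q p] by (auto simp: sigma_commute)
qed

text \<open>Near the equator, longitude and latitude are almost flat coordinates. In 1 - cos
  \<sigma> = (1 - cos (\<phi> - \<psi>)) + cos \<phi> cos \<psi> (1 - cos (s - t)) one factor cos w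
  is lost to the shortening of the parallels, the other to sin x \<ge> x cos w.\<close>

lemma chart_lower:
  assumes w: "w \<le> pi / 2" and \<phi>: "\<bar>\<phi>\<bar> \<le> w" "\<bar>\<psi>\<bar> \<le> w" and t: "\<bar>s - t\<bar> \<le> 2 * w"
  shows "(cos w)\<^sup>2 * dist (s, \<phi>) (t, \<psi>) \<le> sigma (lift (circ s) \<phi>) (lift (circ t) \<psi>)" (is "_ \<le> ?\<sigma>")
proof -
  have half: "1 - cos x = 2 * (sin (x / 2))\<^sup>2" for x :: real
    using cos_double_sin[of "x / 2"] by auto
  have w0: "0 \<le> cos w" using w \<phi> by (intro cos_ge_zero) auto
  have \<sigma>0: "0 \<le> ?\<sigma>" by (intro sigma_nonneg) auto
  have cw: "cos w \<le> cos x" if "\<bar>x\<bar> \<le> w" for x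
    using cos_monotone_0_pi_le[of "\<bar>x\<bar>" w] that w by auto
  have c: "(cos w)\<^sup>2 \<le> cos \<phi> * cos \<psi>"
    unfolding power2_eq_square using \<phi> w0 cw by (intro mult_mono) (auto intro: order_trans)
  have A: "1 - cos x \<ge> x\<^sup>2 * (cos w)\<^sup>2 / 2" if "\<bar>x\<bar> \<le> 2 * w" for x
    using sin_squared_ge[of "x / 2" w] that w by (simp add: half power_divide)
  have split: "1 - cos ?\<sigma> = (1 - cos (\<phi> - \<psi>)) + cos \<phi> * cos \<psi> * (1 - cos (s - t))"
    by (simp add: inner_lift inner_circ cos_diff algebra_simps)
  have "(\<phi> - \<psi>)\<^sup>2 * (cos w)\<^sup>2 / 2 + (cos w)\<^sup>2 * ((s - t)\<^sup>2 * (cos w)\<^sup>2 / 2) \<le> 1 - cos ?\<sigma>"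
    unfolding split
    using \<phi> t c order_trans[OF zero_le_power2 c] by (intro add_mono mult_mono A) auto
  moreover have "(\<phi> - \<psi>)\<^sup>2 * (cos w)^4 \<le> (\<phi> - \<psi>)\<^sup>2 * (cos w)\<^sup>2"
    using w0 by (intro mult_left_mono power_decreasing) auto
  moreover have "(cos w)^4 * ((s - t)\<^sup>2 + (\<phi> - \<psi>)\<^sup>2) =
      2 * ((cos w)\<^sup>2 * ((s - t)\<^sup>2 * (cos w)\<^sup>2 / 2)) + (\<phi> - \<psi>)\<^sup>2 * (cos w)^4"
    by (simp add: distrib_left power4_eq_xxxx power2_eq_square)
  moreover have "e \<le> 2 * c" if "a / 2 + b \<le> c" "d \<le> a" "e = 2 * b + d" for a b c d e :: real
    using that by linarith
  ultimately have "(cos w)^4 * ((s - t)\<^sup>2 + (\<phi> - \<psi>)\<^sup>2) \<le> 2 * (1 - cos ?\<sigma>)"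
    by blast
  also have "2 * (1 - cos ?\<sigma>) = 4 * (sin (?\<sigma> / 2))\<^sup>2" by (simp only: half)
  also have "\<dots> \<le> ?\<sigma>\<^sup>2"
  proof -
    have "(sin (?\<sigma> / 2))\<^sup>2 \<le> (?\<sigma> / 2)\<^sup>2" unfolding abs_le_square_iff[symmetric] by (rule abs_sin_x_le_abs_x)
    then show ?thesis by (simp add: power_divide)
  qed
  finally have "((cos w)\<^sup>2 * dist (s, \<phi>) (t, \<psi>))\<^sup>2 \<le> ?\<sigma>\<^sup>2"
    by (simp add: dist_prod_def dist_real_def power_mult_distrib)
  then show ?thesis using \<sigma>0 by (rule power2_le_imp_le)
qed

text \<open>Orthogonal projection of a cap to the tangent plane at its centre.\<close>
lemma cap_projection:
  assumes x0: "x0 \<in> S2"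
  obtains f :: "real^3 \<Rightarrow> real \<times> real" where
    "\<And>p R. p \<in> S2 \<Longrightarrow> sigma x0 p \<le> R \<Longrightarrow> norm (f p) \<le> R"
    "\<And>p q R. p \<in> S2 \<Longrightarrow> q \<in> S2 \<Longrightarrow> sigma x0 p \<le> R \<Longrightarrow> sigma x0 q \<le> R \<Longrightarrow> R < 1
      \<Longrightarrow> sigma p q \<le> 1 / (sqrt (1 - R\<^sup>2) * cos R) * dist (f p) (f q)"
proof -
  obtain T :: "real^3 \<Rightarrow> real^3" where T: "orthogonal_transformation T" "T x0 = axis 1 1"
    using orthogonal_transformation_exists_1[of x0 "axis 1 1"] x0 by (auto simp: S2_norm norm_axis_1)
  have lin: "T (p - q) = T p - T q" for p q
    using T(1) by (simp add: orthogonal_transformation_def linear_diff)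
  have Tin: "T p \<bullet> T q = p \<bullet> q" for p q using T(1) by (simp add: orthogonal_transformation_def)
  define f where "f = (\<lambda>p. (T p $ 2, T p $ 3))"
  have T1: "T p $ 1 = x0 \<bullet> p" for p using Tin[of x0 p] by (simp add: T(2) inner_axis')
  have nf: "(norm (f p))\<^sup>2 = p \<bullet> p - (x0 \<bullet> p)\<^sup>2" for p
    using Tin[of p p] by (simp add: T1 inner_real3 f_def norm_prod_def power2_eq_square)
  have fd: "f p - f q = f (p - q)" for p q by (simp add: f_def lin)
  have nS: "(norm (f p))\<^sup>2 = 1 - (x0 \<bullet> p)\<^sup>2" if "p \<in> S2" for p using that nf[of p] by (simp add: S2_iff)
  have bound: "norm (f p) \<le> R" if p: "p \<in> S2" and R: "sigma x0 p \<le> R" for p R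
  proof -
    have "(norm (f p))\<^sup>2 = (sin (sigma x0 p))\<^sup>2" using sin_sigma_sq[OF x0 p] nS[OF p] by simp
    then have "norm (f p) = sin (sigma x0 p)"
      by (rule power2_eq_imp_eq) (use sin_sigma_nonneg[OF x0 p] in auto)
    then show ?thesis using sin_x_le_x[OF sigma_nonneg[OF x0 p]] R by simp
  qed
  have lip: "sigma p q \<le> 1 / (sqrt (1 - R\<^sup>2) * cos R) * dist (f p) (f q)"
    if p: "p \<in> S2" and q: "q \<in> S2" and pR: "sigma x0 p \<le> R" and qR: "sigma x0 q \<le> R" and R1: "R < 1" for p q R
  proof -
    have R0: "0 \<le> R" using sigma_nonneg[OF x0 p] pR by simp
    have Rpi: "R < pi / 2" using R1 pi_gt3 by simp
    define k where "k = sqrt (1 - R\<^sup>2)"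
    have R2: "R\<^sup>2 < 1" using R0 R1 by (simp add: abs_square_less_1)
    then have k: "0 < k" "k\<^sup>2 = 1 - R\<^sup>2" by (auto simp: k_def)
    have cR: "0 < cos R" using R0 Rpi by (intro cos_gt_zero_pi) auto
    have ge: "k \<le> x0 \<bullet> z" if z: "z \<in> S2" and zR: "sigma x0 z \<le> R" for z
    proof -
      have "0 \<le> cos (sigma x0 z)" using sigma_nonneg[OF x0 z] zR Rpi by (intro cos_ge_zero) auto
      then have "0 \<le> x0 \<bullet> z" using x0 z by simp
      moreover have "k\<^sup>2 \<le> (x0 \<bullet> z)\<^sup>2"
        using nS[OF z] power_mono[OF bound[OF z zR], of 2] k by simp
      ultimately show ?thesis by (metis power2_le_imp_le)
    qed
    define D where "D = norm (f p - f q)"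
    define e where "e = x0 \<bullet> p - x0 \<bullet> q"
    \<comment> \<open>On the sphere a change \<open>e\<close> of height is tied to a change of the
      norm of the projection, which yields |e| k \<le> D R. As k^2 + R^2 = 1, the chord, whose
      squared length is D^2 + e^2, is at most D / k.\<close>
    have "\<bar>e\<bar> * (2 * k) \<le> \<bar>e\<bar> * \<bar>x0 \<bullet> p + x0 \<bullet> q\<bar>"
      using ge[OF p pR] ge[OF q qR] by (intro mult_left_mono) auto
    also have "\<dots> = \<bar>(norm (f q))\<^sup>2 - (norm (f p))\<^sup>2\<bar>"
      unfolding nS[OF p] nS[OF q] e_def abs_mult[symmetric] by (simp add: power2_eq_square algebra_simps)
    also have "\<dots> = \<bar>norm (f q) - norm (f p)\<bar> * (norm (f q) + norm (f p))"
      by (simp add: power2_eq_square square_diff_square_factored abs_mult mult.commute)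
    also have "\<dots> \<le> D * (R + R)"
      using bound[OF p pR] bound[OF q qR] norm_triangle_ineq3[of "f p" "f q"]
      by (intro mult_mono add_mono) (auto simp: D_def abs_minus_commute)
    finally have "(\<bar>e\<bar> * k)\<^sup>2 \<le> (D * R)\<^sup>2" using k by (intro power_mono) auto
    then have ek: "e\<^sup>2 * k\<^sup>2 \<le> D\<^sup>2 * R\<^sup>2" by (simp add: power_mult_distrib)
    have chord: "(norm (p - q))\<^sup>2 = D\<^sup>2 + e\<^sup>2"
      using nf[of "p - q"] by (simp add: D_def e_def fd inner_diff_right power2_norm_eq_inner)
    have "(norm (p - q))\<^sup>2 * k\<^sup>2 \<le> D\<^sup>2 * k\<^sup>2 + D\<^sup>2 * R\<^sup>2" using ek by (simp add: chord algebra_simps)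
    also have "\<dots> = D\<^sup>2" unfolding k(2) by (simp add: algebra_simps)
    finally have "(norm (p - q) * k)\<^sup>2 \<le> D\<^sup>2" by (simp add: power_mult_distrib)
    then have chordD: "norm (p - q) * k \<le> D" by (rule power2_le_imp_le) (simp add: D_def)
    define s where "s = sigma p q"
    have s: "0 \<le> s" "s \<le> pi" "s / 2 \<le> R"
      using sigma_nonneg[OF p q] sigma_le_pi[OF p q] sigma_triangle[OF p x0 q] pR qR
      by (auto simp: s_def sigma_commute)
    have "(norm (p - q))\<^sup>2 = 2 * (1 - cos s)"
      using p q by (simp add: s_def power2_norm_eq_inner inner_diff inner_commute S2_iff)
    also have "\<dots> = (2 * sin (s / 2))\<^sup>2"
      using cos_double_sin[of "s / 2"] by (simp add: power_mult_distrib)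
    finally have "norm (p - q) = 2 * sin (s / 2)"
      by (rule power2_eq_imp_eq) (use s in \<open>auto intro!: sin_ge_zero\<close>)
    \<comment> \<open>The triangle inequality through the centre of the cap gives s \<le> 2 R, so
      the arc is at most 1 / cos R times the chord.\<close>
    moreover have "s / 2 * cos R \<le> s / 2 * cos (s / 2)"
      using s Rpi by (intro mult_left_mono cos_monotone_0_pi_le) auto
    moreover have "s / 2 * cos (s / 2) \<le> sin (s / 2)" using s by (intro sin_ge_mult_cos) auto
    ultimately have "s * cos R \<le> norm (p - q)" by linarith
    then have "s * cos R * k \<le> norm (p - q) * k" using k by (intro mult_right_mono) auto
    then have "s * (k * cos R) \<le> D" using chordD by (simp add: mult_ac)
    then show ?thesis using k cR by (simp add: s_def[symmetric] k_def[symmetric] D_def[symmetric] dist_norm field_simps)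
  qed
  show ?thesis using that bound lip by blast
qed

section \<open>Chain distance on the glued sphere\<close>

text \<open>Vitali's theorem is applied to the image intervals \<open>{G (t - s)..G (t + s)}\<close>; their disjointness
  passes to the intervals \<open>{t - s..t + s}\<close>.\<close>
lemma increment_le_of_fine_increments:
  fixes G :: "real \<Rightarrow> real"
  assumes cont: "continuous_on UNIV G" and mono: "strict_mono G" and M: "0 \<le> M" and ab: "a \<le> b"
    and fine: "\<And>t \<delta>. 0 < \<delta> \<Longrightarrow> \<exists>s. 0 < s \<and> s < \<delta> \<and> G (t + s) - G (t - s) \<le> 2 * M * s"
  shows "G b - G a \<le> M * (b - a)"
proof -
  have main: "G b - G a \<le> M * (b - a + 2 * e)" if e: "0 < e" for e
  proof -
    define K where "K = {i. 0 < snd i \<and> snd i < e \<and> a \<le> fst i \<and> fst i \<le> b \<and>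
      G (fst i + snd i) - G (fst i - snd i) \<le> 2 * M * snd i}"
    define c where "c = (\<lambda>i. (G (fst i + snd i) + G (fst i - snd i)) / 2)"
    define \<rho> where "\<rho> = (\<lambda>i. (G (fst i + snd i) - G (fst i - snd i)) / 2)"
    have cb: "cball (c i) (\<rho> i) = {G (fst i - snd i)..G (fst i + snd i)}" for i
    proof -
      have "c i - \<rho> i = G (fst i - snd i)" "c i + \<rho> i = G (fst i + snd i)"
        by (simp_all add: c_def \<rho>_def field_simps)
      then show ?thesis by (simp add: cball_eq_atLeastAtMost)
    qed
    have \<rho>: "0 < \<rho> i" if "i \<in> K" for i
      using strict_monoD[OF mono, of "fst i - snd i" "fst i + snd i"] that by (simp add: K_def \<rho>_def)
    \<comment> \<open>What the selected intervals miss is null in the image. Covering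
      \<open>{a..b}\<close> instead would leave a null set whose image under \<open>G\<close> could
      have positive length.\<close>
    obtain C where C: "countable C" "C \<subseteq> K"
      "pairwise (\<lambda>i j. disjnt (cball (c i) (\<rho> i)) (cball (c j) (\<rho> j))) C"
      and neg: "negligible ({G a..G b} - (\<Union>i\<in>C. cball (c i) (\<rho> i)))"
    proof (rule Vitali_covering_theorem_cballs[of K \<rho> "{G a..G b}" c])
      fix x d :: real assume x: "x \<in> {G a..G b}" and d: "0 < d"
      obtain t where t: "a \<le> t" "t \<le> b" "G t = x"
        using IVT'[of G a x b] x ab continuous_on_subset[OF cont] by auto
      have "isCont G t" using cont by (simp add: continuous_on_eq_continuous_at)
      then obtain \<eta> where \<eta>: "0 < \<eta>" "\<And>u. \<bar>u - t\<bar> < \<eta> \<Longrightarrow> \<bar>G u - G t\<bar> < d"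
        using d unfolding continuous_at_eps_delta dist_real_def by blast
      obtain s where s: "0 < s" "s < min e \<eta>" "G (t + s) - G (t - s) \<le> 2 * M * s"
        using fine[of "min e \<eta>" t] e \<eta>(1) by auto
      have "(t, s) \<in> K" using s t by (simp add: K_def)
      moreover have "\<rho> (t, s) < d"
        using \<eta>(2)[of "t + s"] \<eta>(2)[of "t - s"] s by (simp add: \<rho>_def abs_less_iff)
      moreover have "x \<in> cball (c (t, s)) (\<rho> (t, s))"
        using strict_monoD[OF mono, of "t - s" t] strict_monoD[OF mono, of t "t + s"] s t by (simp add: cb)
      ultimately show "\<exists>i. i \<in> K \<and> x \<in> cball (c i) (\<rho> i) \<and> \<rho> i < d" by blast
    qed (rule \<rho>)
    have null: "{G a..G b} - (\<Union>i\<in>C. cball (c i) (\<rho> i)) \<in> null_sets lebesgue"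
      using neg by (simp add: negligible_iff_null_sets)
    have V: "(\<Union>i\<in>C. cball (c i) (\<rho> i)) \<in> sets borel" using C(1) by auto
    have "G a \<le> G b" using ab mono by (simp add: strict_mono_less_eq)
    then have "ennreal (G b - G a) = emeasure lebesgue {G a..G b}" by simp
    also have "\<dots> \<le> emeasure lebesgue ((\<Union>i\<in>C. cball (c i) (\<rho> i)) \<union>
        ({G a..G b} - (\<Union>i\<in>C. cball (c i) (\<rho> i))))"
      using V null by (intro emeasure_mono) auto
    also have "\<dots> = emeasure lebesgue (\<Union>i\<in>C. cball (c i) (\<rho> i))"
      using V null by (intro emeasure_Un_null_set) auto
    also have "\<dots> = emeasure lborel (\<Union>i\<in>C. cball (c i) (\<rho> i))"
      using V by simp
    also have "\<dots> = (\<integral>\<^sup>+i. emeasure lborel (cball (c i) (\<rho> i)) \<partial>count_space C)"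
      using C by (intro emeasure_UN_countable) (auto simp: disjoint_family_on_def pairwise_def disjnt_def)
    also have "\<dots> \<le> (\<integral>\<^sup>+i. ennreal M * emeasure lborel {fst i - snd i..fst i + snd i} \<partial>count_space C)"
    proof (rule nn_integral_mono)
      fix i assume "i \<in> space (count_space C)"
      then have i: "i \<in> K" using C(2) by auto
      then have "emeasure lborel (cball (c i) (\<rho> i)) = ennreal (G (fst i + snd i) - G (fst i - snd i))"
        using \<rho>[OF i] unfolding cb by (simp add: \<rho>_def)
      also have "\<dots> \<le> ennreal (M * (2 * snd i))" using i by (intro ennreal_leI) (simp add: K_def)
      also have "\<dots> = ennreal M * emeasure lborel {fst i - snd i..fst i + snd i}"
        using i M by (simp add: K_def ennreal_mult)
      finally show "emeasure lborel (cball (c i) (\<rho> i)) \<le> ennreal M * emeasure lborel {fst i - snd i..fst i + snd i}" .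
    qed
    also have "\<dots> = ennreal M * (\<integral>\<^sup>+i. emeasure lborel {fst i - snd i..fst i + snd i} \<partial>count_space C)"
      by (intro nn_integral_cmult) auto
    also have "\<dots> = ennreal M * emeasure lborel (\<Union>i\<in>C. {fst i - snd i..fst i + snd i})"
    proof -
      have "disjoint_family_on (\<lambda>i. {fst i - snd i..fst i + snd i}) C"
        unfolding disjoint_family_on_def
      proof (intro ballI impI)
        fix i j assume ij: "i \<in> C" "j \<in> C" "i \<noteq> j"
        have False if "v \<in> {fst i - snd i..fst i + snd i}" "v \<in> {fst j - snd j..fst j + snd j}" for v
        proof -
          have "G v \<in> cball (c i) (\<rho> i)" "G v \<in> cball (c j) (\<rho> j)"
            using that mono by (simp_all add: cb strict_mono_less_eq)
          then show False using pairwiseD[OF C(3) ij(1,2,3)] by (auto simp: disjnt_iff simp del: mem_cball)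
        qed
        then show "{fst i - snd i..fst i + snd i} \<inter> {fst j - snd j..fst j + snd j} = {}" by blast
      qed
      then show ?thesis using C(1) by (subst emeasure_UN_countable) auto
    qed
    also have "\<dots> \<le> ennreal M * emeasure lborel {a - e..b + e}"
    proof -
      have "(\<Union>i\<in>C. {fst i - snd i..fst i + snd i}) \<subseteq> {a - e..b + e}"
        using C(2) by (fastforce simp: K_def)
      then show ?thesis by (intro mult_left_mono emeasure_mono) auto
    qed
    also have "\<dots> = ennreal (M * (b - a + 2 * e))"
    proof -
      have "emeasure lborel {a - e..b + e} = ennreal (b - a + 2 * e)"
        using ab e by (simp add: algebra_simps)
      then show ?thesis using ab e M by (simp add: ennreal_mult add.commute)
    qed
    finally show ?thesis using M ab e by (simp add: mult_nonneg_nonneg)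
  qed
  show ?thesis
  proof (rule field_le_epsilon)
    fix e :: real assume e: "0 < e"
    have "G b - G a \<le> M * (b - a + 2 * (e / (2 * (M + 1))))"
      by (rule main) (use e M in simp)
    also have "\<dots> = M * (b - a) + e * (M / (M + 1))" using M by (simp add: field_simps)
    also have "\<dots> \<le> M * (b - a) + e * 1"
      using M e by (intro add_left_mono mult_left_mono) (auto simp: field_simps)
    finally show "G b - G a \<le> M * (b - a) + e" by simp
  qed
qed

lemma ennreal_INF_const_add':
  fixes f :: "'i \<Rightarrow> ennreal"
  assumes "I \<noteq> {}"
  shows "(INF i\<in>I. c + f i) = c + (INF i\<in>I. f i)"
  using continuous_at_Inf_mono[of "\<lambda>x. c + x" "f ` I"] assms
    continuous_add[of "at_right (Inf (f ` I))" "\<lambda>x. c" "\<lambda>x. x"]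
  by (auto simp: mono_def image_comp)

section \<open>The chain pseudodistance of a bijective gluing\<close>

locale gluing =
  fixes g :: "real^3 \<Rightarrow> real^3"
  assumes bij: "bij_betw g S1 S1"
begin

lemma g_S1 [simp]: "a \<in> S1 \<Longrightarrow> g a \<in> S1"
  using bij by (auto simp: bij_betw_def)

lemma g_S2 [simp]: "a \<in> S1 \<Longrightarrow> g a \<in> S2"
  using g_S1 S1_subset_S2 by blast

lemma g_surjE:
  assumes "b \<in> S1" obtains a where "a \<in> S1" "g a = b"
proof -
  have "b \<in> g ` S1" using bij_betw_imp_surj_on[OF bij] assms by simp
  then show ?thesis using that by blast
qed

lemma Zset_S2: "(c, p) \<in> Zset \<Longrightarrow> p \<in> S2"
  by (auto simp: Zset_def Zs_closed_def Zn_def)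

lemma False_in_Zset [simp]: "(False, p) \<in> Zset \<longleftrightarrow> p \<in> S2 \<and> p$3 \<le> 0"
  by (auto simp: Zset_def Zs_closed_def)

lemma True_in_Zset [simp]: "(True, p) \<in> Zset \<longleftrightarrow> p \<in> S2 \<and> 0 < p$3"
  by (auto simp: Zset_def Zn_def)

lemma S1_in_Zset [simp]: "a \<in> S1 \<Longrightarrow> (False, a) \<in> Zset"
  by (simp add: S1_def)

lemma DZ_simps:
  "DZ g (False, a) (False, b) = (if a \<in> S1 \<and> b \<in> S1 then ennreal (min (sigma a b) (sigma (g a) (g b)))
            else ennreal (sigma a b))"
  "DZ g (False, a) (True, q) = (if a \<in> S1 then ennreal (sigma (g a) q) else \<infinity>)"
  "DZ g (True, q) (False, a) = (if a \<in> S1 then ennreal (sigma q (g a)) else \<infinity>)"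
  "DZ g (True, p) (True, q) = ennreal (sigma p q)"
  by (simp_all add: DZ_def)

lemma DZ_False_le: "DZ g (False, a) (False, b) \<le> ennreal (sigma a b)"
  by (simp add: DZ_simps ennreal_leI)

lemma DZ_commute: "DZ g x y = DZ g y x"
  by (cases x; cases y; cases "fst x"; cases "fst y") (auto simp: DZ_simps sigma_commute)

lemma dZ_le_DZ:
  assumes "x \<in> Zset" "y \<in> Zset" shows "dZ g x y \<le> DZ g x y"
  unfolding dZ_def
  by (rule INF_lower2[of "(1, \<lambda>k. if k = 0 then x else y)"]) (use assms in auto)

lemma dZ_prepend:
  assumes z: "z \<in> Zset" shows "dZ g z x \<le> DZ g z y + dZ g y x"
proof -
  let ?I = "{(n, c :: nat \<Rightarrow> bool \<times> (real^3)). 0 < n \<and> c 0 = y \<and> c n = x \<and> (\<forall>k\<le>n. c k \<in> Zset)}"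
  let ?f = "\<lambda>nc. \<Sum>k<fst nc. DZ g (snd nc k) (snd nc (Suc k))"
  have main: "dZ g z x \<le> DZ g z y + ?f nc" if "nc \<in> ?I" for nc
  proof -
    obtain n c where nc: "nc = (n, c)" "0 < n" "c 0 = y" "c n = x" "\<And>k. k \<le> n \<Longrightarrow> c k \<in> Zset"
      using \<open>nc \<in> ?I\<close> by auto
    define c' where "c' = (\<lambda>k. case k of 0 \<Rightarrow> z | Suc j \<Rightarrow> c j)"
    have "dZ g z x \<le> (\<Sum>k<Suc n. DZ g (c' k) (c' (Suc k)))"
      unfolding dZ_def
      by (rule INF_lower2[of "(Suc n, c')"]) (use nc z in \<open>auto simp: c'_def split: nat.splits\<close>)
    also have "\<dots> = DZ g z y + ?f nc"
      unfolding sum.lessThan_Suc_shift using nc by (simp add: c'_def)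
    finally show ?thesis .
  qed
  show ?thesis
  proof (cases "?I = {}")
    case True
    then show ?thesis unfolding dZ_def[of g y x] by (simp only: image_empty Inf_empty) simp
  next
    case False
    have "dZ g z x \<le> (INF nc\<in>?I. DZ g z y + ?f nc)" by (intro INF_greatest main)
    also have "\<dots> = DZ g z y + dZ g y x"
      unfolding dZ_def by (rule ennreal_INF_const_add'[OF False])
    finally show ?thesis .
  qed
qed

text \<open>\<open>dZ\<close> is the largest pseudodistance below \<open>DZ\<close>: a bound that
  holds for single links telescopes along chains. The lower bounds for \<open>dZ\<close> are all
  obtained by exhibiting a suitable function \<open>f\<close>.\<close>

lemma dZ_lipschitz:
  fixes f :: "bool \<times> (real^3) \<Rightarrow> ennreal"
  assumes f: "\<And>y z. y \<in> Zset \<Longrightarrow> z \<in> Zset \<Longrightarrow> f z \<le> f y + DZ g y z"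
    and y: "y \<in> Zset" and z: "z \<in> Zset"
  shows "f z \<le> f y + dZ g y z"
proof -
  let ?I = "{(n, c :: nat \<Rightarrow> bool \<times> (real^3)). 0 < n \<and> c 0 = y \<and> c n = z \<and> (\<forall>k\<le>n. c k \<in> Zset)}"
  let ?f = "\<lambda>nc. \<Sum>k<fst nc. DZ g (snd nc k) (snd nc (Suc k))"
  have "(1, \<lambda>k. if k = 0 then y else z) \<in> ?I" using y z by auto
  then have "?I \<noteq> {}" by blast
  have le: "f z \<le> f y + ?f nc" if nc: "nc \<in> ?I" for nc
  proof -
    obtain n c where nc: "nc = (n, c)" "c 0 = y" "c n = z" "\<And>k. k \<le> n \<Longrightarrow> c k \<in> Zset"
      using nc by auto
    have "f (c m) \<le> f (c 0) + (\<Sum>k<m. DZ g (c k) (c (Suc k)))" if "m \<le> n" for m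
      using that
    proof (induction m)
      case (Suc m)
      have "f (c (Suc m)) \<le> f (c m) + DZ g (c m) (c (Suc m))" using Suc.prems nc(4) by (intro f) auto
      also have "\<dots> \<le> f (c 0) + (\<Sum>k<m. DZ g (c k) (c (Suc k))) + DZ g (c m) (c (Suc m))"
        using Suc by (intro add_right_mono) auto
      finally show ?case by (simp add: add.assoc)
    qed simp
    from this[of n] show ?thesis using nc by simp
  qed
  have "f z \<le> (INF nc\<in>?I. f y + ?f nc)" by (intro INF_greatest le)
  also have "\<dots> = f y + dZ g y z" unfolding dZ_def by (rule ennreal_INF_const_add'[OF \<open>?I \<noteq> {}\<close>])
  finally show ?thesis .
qed

lemma dZ_self [simp]:
  assumes "x \<in> Zset" shows "dZ g x x = 0"
proof -
  have "DZ g x x = 0" using assms Zset_S2[of "fst x" "snd x"]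
    by (cases x; cases "fst x") (auto simp: DZ_simps)
  then show ?thesis using dZ_le_DZ[OF assms assms] by simp
qed

text \<open>Prepending a link shows that \<open>dZ g z x\<close>, as a function of \<open>z\<close>,
  is 1-Lipschitz for \<open>DZ\<close>. The arguments stand in an order for which the case
  \<open>y = x\<close> already yields symmetry.\<close>

lemma dZ_triangle':
  assumes "x \<in> Zset" "y \<in> Zset" "z \<in> Zset" shows "dZ g z x \<le> dZ g y x + dZ g y z"
proof (rule dZ_lipschitz[of "\<lambda>z. dZ g z x"])
  show "dZ g v x \<le> dZ g u x + DZ g u v" if "v \<in> Zset" for u v
    using dZ_prepend[OF that, of x u] by (simp add: DZ_commute[of u] add.commute)
qed (use assms in auto)

lemma dZ_commute:
  assumes "x \<in> Zset" "y \<in> Zset" shows "dZ g x y = dZ g y x"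
  using dZ_triangle'[of y y x] dZ_triangle'[of x x y] assms by (intro antisym) auto

lemma dZ_triangle:
  assumes "x \<in> Zset" "y \<in> Zset" "z \<in> Zset" shows "dZ g x z \<le> dZ g x y + dZ g y z"
  using dZ_triangle'[of z y x] assms by (simp add: dZ_commute add.commute)

lemma dZ_finite:
  assumes "x \<in> Zset" "y \<in> Zset" shows "dZ g x y < \<infinity>"
proof -
  have *: "dZ g (False, circ 0) z < \<infinity>" if "z \<in> Zset" for z
  proof -
    have "DZ g (False, circ 0) z < \<infinity>" by (cases z; cases "fst z") (auto simp: DZ_simps)
    then show ?thesis using dZ_le_DZ[of "(False, circ 0)" z] that by (auto intro: le_less_trans)
  qed
  have "dZ g x y \<le> dZ g (False, circ 0) y + dZ g (False, circ 0) x"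
    using dZ_triangle'[of y "(False, circ 0)" x] assms by simp
  then show ?thesis using *[OF assms(1)] *[OF assms(2)] by (auto intro: le_less_trans)
qed

lemma Qmap_self: "x \<in> Zset \<Longrightarrow> x \<in> Qmap g x"
  by (simp add: Qmap_def)

lemma Qmap_eq_iff:
  assumes x: "x \<in> Zset" and y: "y \<in> Zset" shows "Qmap g x = Qmap g y \<longleftrightarrow> dZ g x y = 0"
proof
  assume "Qmap g x = Qmap g y"
  then have "y \<in> Qmap g x" using Qmap_self[OF y] by simp
  then show "dZ g x y = 0" by (simp add: Qmap_def)
next
  assume 0: "dZ g x y = 0"
  have "dZ g x z = 0 \<longleftrightarrow> dZ g y z = 0" if z: "z \<in> Zset" for z
    using dZ_triangle[OF x y z] dZ_triangle[OF y x z] 0 dZ_commute[OF x y] by auto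
  then show "Qmap g x = Qmap g y" by (auto simp: Qmap_def)
qed

lemma dtil_Qmap:
  assumes x: "x \<in> Zset" and y: "y \<in> Zset"
  shows "dtil g (Qmap g x) (Qmap g y) = enn2real (dZ g x y)"
proof -
  define x' where "x' = (SOME z. z \<in> Qmap g x)"
  define y' where "y' = (SOME z. z \<in> Qmap g y)"
  have "x' \<in> Qmap g x" "y' \<in> Qmap g y"
    unfolding x'_def y'_def using Qmap_self[OF x] Qmap_self[OF y] by (auto intro: someI)
  then have *: "x' \<in> Zset" "y' \<in> Zset" "dZ g x x' = 0" "dZ g y y' = 0" "dZ g x' x = 0" "dZ g y' y = 0"
    using dZ_commute x y by (auto simp: Qmap_def)
  have "dZ g x' y' \<le> dZ g x' x + (dZ g x y + dZ g y y')"
    using dZ_triangle[OF *(1) x *(2)] dZ_triangle[OF x y *(2)] by (meson add_left_mono order_trans)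
  moreover have "dZ g x y \<le> dZ g x x' + (dZ g x' y' + dZ g y' y)"
    using dZ_triangle[OF x *(1) y] dZ_triangle[OF *(1,2) y] by (meson add_left_mono order_trans)
  ultimately have "dZ g x' y' = dZ g x y" using * by simp
  then show ?thesis by (simp add: dtil_def x'_def y'_def)
qed

lemma ennreal_dtil:
  assumes "x \<in> Zset" "y \<in> Zset"
  shows "ennreal (dtil g (Qmap g x) (Qmap g y)) = dZ g x y"
  using dZ_finite[OF assms] by (simp add: dtil_Qmap[OF assms])

text \<open>The minimum, as a function of \<open>q\<close>, equals \<open>\<bar>lat p\<bar>\<close> on the seam; extended by this constant to the
  other hemisphere it is 1-Lipschitz for \<open>D\<close>.\<close>
lemma dZ_ge_min:
  assumes p: "(b, p) \<in> Zset" and q: "(b, q) \<in> Zset"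
  shows "ennreal (min (sigma p q) (\<bar>lat p\<bar> + \<bar>lat q\<bar>)) \<le> dZ g (b, p) (b, q)"
proof -
  define F where "F = (\<lambda>q. min (sigma p q) (\<bar>lat p\<bar> + \<bar>lat q\<bar>))"
  define f where "f = (\<lambda>z. if fst z = b then F (snd z) else \<bar>lat p\<bar>)"
  have pS: "p \<in> S2" using p by (rule Zset_S2)
  have F0: "0 \<le> F u" if "u \<in> S2" for u using sigma_nonneg[OF pS that] by (simp add: F_def)
  have F1: "F u = \<bar>lat p\<bar>" if u: "u \<in> S1" for u
    using lat_lipschitz[of p u] u pS S1_subset_S2 by (auto simp: F_def)
  have Flip: "F v \<le> F u + sigma u v" if u: "u \<in> S2" and v: "v \<in> S2" for u v
    using sigma_triangle[OF pS u v] lat_lipschitz[OF u v] by (auto simp: F_def min_def)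
  have f0: "0 \<le> f z" if "z \<in> Zset" for z using F0 that Zset_S2[of "fst z" "snd z"] by (auto simp: f_def)
  have step: "ennreal (f z) \<le> ennreal (f y) + ennreal s" if "y \<in> Zset" "0 \<le> s" "f z \<le> f y + s" for y z s
    using that f0[OF that(1)] by (simp add: ennreal_plus[symmetric] ennreal_leI del: ennreal_plus)
  have "ennreal (f z) \<le> ennreal (f y) + DZ g y z" if y: "y \<in> Zset" and z: "z \<in> Zset" for y z
  proof -
    obtain c u where yc: "y = (c, u)" by (cases y)
    obtain c' v where zc: "z = (c', v)" by (cases z)
    have u: "u \<in> S2" and v: "v \<in> S2" using y z yc zc Zset_S2 by auto
    have g0: "u \<in> S1 \<Longrightarrow> 0 \<le> sigma (g u) v" "v \<in> S1 \<Longrightarrow> 0 \<le> sigma u (g v)"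
      "u \<in> S1 \<Longrightarrow> v \<in> S1 \<Longrightarrow> 0 \<le> sigma (g u) (g v)" "0 \<le> sigma u v"
      using u v by (auto intro!: sigma_nonneg)
    have lip: "f z \<le> f y + sigma u v" if "c = c'"
      using Flip[OF u v] g0(4) that by (auto simp: f_def yc zc)
    show ?thesis
    proof (cases c; cases c')
      assume cc: "\<not> c" "\<not> c'"
      show ?thesis
      proof (cases "u \<in> S1 \<and> v \<in> S1")
        case True
        \<comment> \<open>Along the seam \<open>f\<close> is constant, so the estimate holds however
          short the minimum in \<open>DZ\<close> makes the link.\<close>
        then have "f z = f y" using cc F1 by (auto simp: f_def yc zc)
        then show ?thesis by simp
      next
        case False
        then show ?thesis using step[OF y g0(4) lip] cc by (auto simp: yc zc DZ_simps)
      qed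
    next
      assume cc: "c" "c'"
      then show ?thesis using step[OF y g0(4) lip] by (auto simp: yc zc DZ_simps)
    next
      assume cc: "\<not> c" "c'"
      show ?thesis
      proof (cases "u \<in> S1")
        case True
        have "f z \<le> f y + sigma (g u) v"
          using cc F1[OF True] F1[OF g_S1[OF True]] Flip[OF g_S2[OF True] v] g0(1)[OF True] by (auto simp: f_def yc zc)
        from step[OF y g0(1)[OF True] this] show ?thesis using True cc by (auto simp: yc zc DZ_simps)
      qed (use cc in \<open>auto simp: yc zc DZ_simps\<close>)
    next
      assume cc: "c" "\<not> c'"
      show ?thesis
      proof (cases "v \<in> S1")
        case True
        have "f z \<le> f y + sigma u (g v)"
          using cc F1[OF True] F1[OF g_S1[OF True]] Flip[OF u g_S2[OF True]] g0(2)[OF True] by (auto simp: f_def yc zc)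
        from step[OF y g0(2)[OF True] this] show ?thesis using True cc by (auto simp: yc zc DZ_simps)
      qed (use cc in \<open>auto simp: yc zc DZ_simps\<close>)
    qed
  qed
  from dZ_lipschitz[of "\<lambda>z. ennreal (f z)", OF this p q]
  have "ennreal (f (b, q)) \<le> ennreal (f (b, p)) + dZ g (b, p) (b, q)" .
  moreover have "f (b, p) = 0" using pS by (simp add: f_def F_def)
  ultimately show ?thesis by (simp add: f_def F_def)
qed

end

section \<open>Bi-Lipschitz gluing maps\<close>

text \<open>For latitudes of one sign the term sin \<phi> sin \<psi> is nonnegative, as
  \<open>arccos_stretch\<close> requires. For latitudes of opposite signs it is negative, which is
  why an arc between the hemispheres has to be cut.\<close>

lemma sigma_lift_stretch:
  assumes S1: "a \<in> S1" "b \<in> S1" "a' \<in> S1" "b' \<in> S1" and L: "1 \<le> L"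
    and le: "sigma a' b' \<le> L * sigma a b"
    and \<phi>: "-(pi / 2) \<le> \<phi>" "\<phi> \<le> 0" and \<psi>: "-(pi / 2) \<le> \<psi>" "\<psi> \<le> 0"
  shows "sigma (lift a' \<phi>) (lift b' \<psi>) \<le> L * sigma (lift a \<phi>) (lift b \<psi>)"
proof -
  have S2: "a \<in> S2" "b \<in> S2" "a' \<in> S2" "b' \<in> S2" using S1 S1_subset_S2 by auto
  have eq: "sigma (lift x \<phi>) (lift y \<psi>) = arccos (sin \<phi> * sin \<psi> + cos \<phi> * cos \<psi> * cos (sigma x y))"
    if "x \<in> S1" "y \<in> S1" for x y
  proof -
    have "x \<in> S2" "y \<in> S2" using that S1_subset_S2 by auto
    then show ?thesis using that by (simp add: sigma_def[of "lift x \<phi>"] inner_lift)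
  qed
  have "0 \<le> sin (- \<phi>) * sin (- \<psi>)" using \<phi> \<psi> by (intro mult_nonneg_nonneg sin_ge_zero) auto
  moreover have "0 \<le> cos \<phi> * cos \<psi>" using \<phi> \<psi> by (intro mult_nonneg_nonneg cos_ge_zero) auto
  moreover have "cos \<phi> * cos \<psi> + sin \<phi> * sin \<psi> \<le> 1" by (simp flip: cos_diff)
  ultimately show ?thesis
    unfolding eq[OF S1(1,2)] eq[OF S1(3,4)] using L le S2
    by (intro arccos_stretch) (auto simp: sigma_nonneg sigma_le_pi)
qed

text \<open>The combination \<open>q$3 *\<^sub>R p - p$3 *\<^sub>R q\<close> has third coordinate
  zero and nonnegative coefficients, so its normalisation lies on a shortest arc. It vanishes only
  for antipodal points, and then any equatorial point will do.\<close>

lemma equator_crossing: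
  assumes p: "p \<in> S2" "p$3 \<le> 0" and q: "q \<in> S2" "0 < q$3"
  obtains m where "m \<in> S1" "sigma p m + sigma m q = sigma p q"
proof (cases "q$3 *\<^sub>R p - p$3 *\<^sub>R q = 0")
  case True
  then have eq: "q$3 *\<^sub>R p = p$3 *\<^sub>R q" by simp
  then have "norm (q$3 *\<^sub>R p) = norm (p$3 *\<^sub>R q)" by simp
  then have "q$3 = - (p$3)" using p q by (simp add: S2_norm)
  then have "q$3 *\<^sub>R p = q$3 *\<^sub>R (- q)" using eq by simp
  then have "p = - q" using q(2) by (simp only: scaleR_cancel_left) auto
  moreover have "sigma (- q) (circ 0) + sigma (circ 0) q = sigma (- q) q"
    using S2_inner_bounds[OF q(1) circ_in_S2] q(1)
    by (simp add: sigma_def arccos_minus inner_commute S2_iff)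
  ultimately show ?thesis using that[of "circ 0"] by simp
next
  case False
  define w where "w = q$3 *\<^sub>R p - p$3 *\<^sub>R q"
  define m where "m = (1 / norm w) *\<^sub>R w"
  have w: "norm w \<noteq> 0" using False by (simp add: w_def)
  have "w$3 = 0" by (simp add: w_def)
  then have mS1: "m \<in> S1" using w by (simp add: m_def S1_def S2_def)
  have "m = (1 / norm w) *\<^sub>R (q$3 *\<^sub>R p - p$3 *\<^sub>R q)"
    by (simp only: m_def flip: w_def)
  then have "m = (q$3 / norm w) *\<^sub>R p + (- (p$3) / norm w) *\<^sub>R q"
    by (simp add: scaleR_diff_right)
  moreover have "m \<in> S2" using mS1 S1_subset_S2 by blast
  ultimately have "sigma p m + sigma m q = sigma p q"
    by (rule sigma_between[OF p(1) q(1)]) (use p q in \<open>auto intro: divide_nonpos_nonneg\<close>)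
  then show ?thesis using mS1 by (intro that)
qed

lemma southern_liftE:
  assumes "p \<in> S2" "p$3 \<le> 0"
  obtains a \<phi> where "a \<in> S1" "-(pi / 2) \<le> \<phi>" "\<phi> \<le> 0" "p = lift a \<phi>"
proof -
  obtain a \<phi> where a: "a \<in> S1" "-(pi / 2) \<le> \<phi>" "\<phi> \<le> pi / 2" "p = lift a \<phi>"
    using assms(1) by (rule S2_liftE)
  have "\<not> 0 < \<phi>" using a assms(2) sin_gt_zero[of \<phi>] by (auto simp: lift_nth_3)
  then show ?thesis using a that by auto
qed

text \<open>At the poles the argument of \<open>g\<close> is junk, but its coefficient vanishes.\<close>
definition suspension :: "(real^3 \<Rightarrow> real^3) \<Rightarrow> real^3 \<Rightarrow> real^3" where
  "suspension g p = sqrt (1 - (p$3)\<^sup>2) *\<^sub>R g ((1 / sqrt (1 - (p$3)\<^sup>2)) *\<^sub>R (p - p$3 *\<^sub>R axis 3 1)) + p$3 *\<^sub>R axis 3 1"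

lemma suspension_lift:
  assumes a: "a \<in> S1" and \<phi>: "-(pi / 2) \<le> \<phi>" "\<phi> \<le> pi / 2"
  shows "suspension g (lift a \<phi>) = lift (g a) \<phi>"
proof -
  have c: "sqrt (1 - (sin \<phi>)\<^sup>2) = cos \<phi>"
    using cos_ge_zero[OF \<phi>] by (simp add: cos_squared_eq[symmetric])
  show ?thesis
  proof (cases "cos \<phi> = 0")
    case False
    have "(1 / cos \<phi>) *\<^sub>R (lift a \<phi> - sin \<phi> *\<^sub>R axis 3 1) = a" using False by (simp add: lift_def)
    then show ?thesis unfolding suspension_def lift_nth_3[OF a] c by (simp add: lift_def)
  qed (simp add: suspension_def lift_nth_3[OF a] c lift_def)
qed

text \<open>Antipodal points realise the largest distance pi, so pi / L \<le> L pi. The bound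
  matters because straightening leaves the northern hemisphere fixed, and the identity is
  L-bi-Lipschitz only for 1 \<le> L.\<close>

lemma bilip_ge_1:
  assumes "bilip sigma S1 sigma L g" shows "1 \<le> L"
proof (rule ccontr)
  assume "\<not> 1 \<le> L"
  then have L: "0 < L" "L < 1" using assms by (auto simp: bilip_def)
  have s: "sigma (circ 0) (circ pi) = pi" by (simp add: sigma_circ_eq)
  have "pi / L \<le> L * pi" using assms circ_in_S1[of 0] circ_in_S1[of pi] unfolding bilip_def by (metis s order_trans)
  then have "pi \<le> L * L * pi" using L by (simp add: field_simps)
  moreover have "L * L < 1 * 1" using L by (intro mult_strict_mono) auto
  ultimately show False using mult_strict_right_mono[of "L * L" 1 pi] by simp
qed

context gluing
begin

text \<open>The two branches fit together along the seam: a seam point is represented by its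
  southern coordinate \<open>a\<close>, where \<open>suspension g\<close> takes the value
  \<open>g a\<close>, its northern coordinate.\<close>

definition straighten :: "bool \<times> (real^3) \<Rightarrow> real^3" where
  "straighten z = (if fst z then snd z else suspension g (snd z))"

lemma straighten_S1: "a \<in> S1 \<Longrightarrow> straighten (False, a) = g a"
  using suspension_lift[of a 0] by (simp add: straighten_def)

lemma straighten_south:
  assumes "(False, p) \<in> Zset"
  obtains a \<phi> where "a \<in> S1" "-(pi / 2) \<le> \<phi>" "\<phi> \<le> 0" "p = lift a \<phi>" "straighten (False, p) = lift (g a) \<phi>"
proof -
  obtain a \<phi> where "a \<in> S1" "-(pi / 2) \<le> \<phi>" "\<phi> \<le> 0" "p = lift a \<phi>"
    using assms by (auto elim: southern_liftE)
  then show ?thesis using that suspension_lift[of a \<phi>] by (simp add: straighten_def)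
qed

lemma straighten_in_S2:
  assumes "z \<in> Zset" shows "straighten z \<in> S2"
proof (cases z)
  case (Pair c p)
  show ?thesis
  proof (cases c)
    case False
    then obtain a \<phi> where "a \<in> S1" "straighten (False, p) = lift (g a) \<phi>"
      using assms Pair straighten_south[of p] by metis
    then show ?thesis using False Pair by simp
  qed (use assms Pair in \<open>simp add: straighten_def\<close>)
qed

lemma straighten_surj:
  assumes "q \<in> S2" obtains z where "z \<in> Zset" "straighten z = q"
proof (cases "0 < q$3")
  case True
  then show ?thesis using assms that[of "(True, q)"] by (simp add: straighten_def)
next
  case False
  then obtain b \<phi> where b: "b \<in> S1" "-(pi / 2) \<le> \<phi>" "\<phi> \<le> 0" "q = lift b \<phi>"
    using assms by (auto elim: southern_liftE)
  obtain a where a: "a \<in> S1" "g a = b" using b(1) by (rule g_surjE)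
  have "sin \<phi> \<le> 0" using b sin_ge_zero[of "- \<phi>"] by simp
  then have "(False, lift a \<phi>) \<in> Zset" using a by (simp add: lift_nth_3)
  moreover have "straighten (False, lift a \<phi>) = q"
    using a b suspension_lift[of a \<phi>] by (simp add: straighten_def)
  ultimately show ?thesis by (rule that)
qed

lemma sigma_straighten_south:
  assumes L: "bilip sigma S1 sigma L g" and x: "(False, p) \<in> Zset" and y: "(False, q) \<in> Zset"
  shows "sigma (straighten (False, p)) (straighten (False, q)) \<le> L * sigma p q"
    and "sigma p q \<le> L * sigma (straighten (False, p)) (straighten (False, q))"
proof -
  obtain a \<phi> where a: "a \<in> S1" "-(pi / 2) \<le> \<phi>" "\<phi> \<le> 0" "p = lift a \<phi>" "straighten (False, p) = lift (g a) \<phi>"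
    using x by (rule straighten_south)
  obtain b \<psi> where b: "b \<in> S1" "-(pi / 2) \<le> \<psi>" "\<psi> \<le> 0" "q = lift b \<psi>" "straighten (False, q) = lift (g b) \<psi>"
    using y by (rule straighten_south)
  have L1: "1 \<le> L" using L by (rule bilip_ge_1)
  have "sigma (g a) (g b) \<le> L * sigma a b" "sigma a b / L \<le> sigma (g a) (g b)"
    using L a(1) b(1) by (auto simp: bilip_def)
  moreover have "sigma a b \<le> L * sigma (g a) (g b)"
    using \<open>sigma a b / L \<le> _\<close> L1 by (simp add: field_simps)
  ultimately show "sigma (straighten (False, p)) (straighten (False, q)) \<le> L * sigma p q"
    "sigma p q \<le> L * sigma (straighten (False, p)) (straighten (False, q))"
    using a b L1 by (simp_all add: sigma_lift_stretch)
qed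

text \<open>By \<open>dZ_lipschitz\<close> it is enough to compare single links. A link along the
  seam offers two lengths: for \<open>sigma a b\<close> the Lipschitz bound of \<open>g\<close>
  applies, while \<open>sigma (g a) (g b)\<close> is itself the distance of the images, and 1 \<le>
  L suffices.\<close>

lemma sigma_straighten_le_dZ:
  assumes L: "bilip sigma S1 sigma L g" and x: "x \<in> Zset" and y: "y \<in> Zset"
  shows "ennreal (sigma (straighten x) (straighten y) / L) \<le> dZ g x y"
proof -
  have L1: "1 \<le> L" using L by (rule bilip_ge_1)
  have nn: "0 \<le> sigma (straighten u) (straighten v)" if "u \<in> Zset" "v \<in> Zset" for u v
    using that by (simp add: sigma_nonneg straighten_in_S2)
  have weak: "s / L \<le> s" if "0 \<le> s" for s
    using that L1 mult_left_mono[of 1 L s] by (simp add: divide_le_eq)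
  have key: "ennreal (sigma (straighten u) (straighten v) / L) \<le> DZ g u v" if u: "u \<in> Zset" and v: "v \<in> Zset" for u v
  proof -
    obtain c p where uc: "u = (c, p)" by (cases u)
    obtain c' q where vc: "v = (c', q)" by (cases v)
    have S: "p \<in> S2" "q \<in> S2" using u v uc vc Zset_S2 by auto
    show ?thesis
    proof (cases c; cases c')
      assume cc: "\<not> c" "\<not> c'"
      have "sigma (straighten u) (straighten v) / L \<le> sigma p q"
        using sigma_straighten_south(1)[OF L, of p q] u v uc vc cc L1 by (simp add: divide_le_eq mult.commute)
      moreover have "sigma (straighten u) (straighten v) / L \<le> sigma (g p) (g q)" if "p \<in> S1" "q \<in> S1"
        using weak[OF nn[OF u v]] that cc by (simp add: uc vc straighten_S1)
      ultimately show ?thesis using cc by (auto simp: uc vc DZ_simps intro!: ennreal_leI)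
    next
      assume "c" "c'"
      then show ?thesis using weak[OF nn[OF u v]] by (simp add: uc vc DZ_simps straighten_def ennreal_leI)
    next
      assume "\<not> c" "c'"
      then show ?thesis using weak[OF nn[OF u v]] straighten_S1[of p]
        by (auto simp: uc vc DZ_simps straighten_def intro!: ennreal_leI)
    next
      assume "c" "\<not> c'"
      then show ?thesis using weak[OF nn[OF u v]] straighten_S1[of q]
        by (auto simp: uc vc DZ_simps straighten_def intro!: ennreal_leI)
    qed
  qed
  have "ennreal (sigma (straighten x) (straighten y) / L) \<le> ennreal (sigma (straighten x) (straighten x) / L) + dZ g x y"
  proof (rule dZ_lipschitz[OF _ x y])
    fix u v assume u: "u \<in> Zset" and v: "v \<in> Zset"
    have "sigma (straighten x) (straighten v) / L \<le> sigma (straighten x) (straighten u) / L + sigma (straighten u) (straighten v) / L"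
      using sigma_triangle[OF straighten_in_S2[OF x] straighten_in_S2[OF u] straighten_in_S2[OF v]] L1
      by (simp add: add_divide_distrib[symmetric] divide_right_mono)
    then have "ennreal (sigma (straighten x) (straighten v) / L) \<le>
        ennreal (sigma (straighten x) (straighten u) / L) + ennreal (sigma (straighten u) (straighten v) / L)"
      using nn[OF x u] nn[OF u v] L1 by (simp add: ennreal_plus[symmetric] ennreal_leI del: ennreal_plus)
    also have "\<dots> \<le> ennreal (sigma (straighten x) (straighten u) / L) + DZ g u v"
      by (intro add_left_mono key u v)
    finally show "ennreal (sigma (straighten x) (straighten v) / L) \<le>
        ennreal (sigma (straighten x) (straighten u) / L) + DZ g u v" .
  qed
  then show ?thesis using x by (simp add: straighten_in_S2)
qed

lemma dZ_le_sigma_straighten: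
  assumes L: "bilip sigma S1 sigma L g" and x: "x \<in> Zset" and y: "y \<in> Zset"
  shows "dZ g x y \<le> ennreal (L * sigma (straighten x) (straighten y))"
proof -
  have L1: "1 \<le> L" using L by (rule bilip_ge_1)
  have weak: "s \<le> L * s" if "0 \<le> s" for s
    using that L1 mult_right_mono[of 1 L s] by simp
  have ss: "dZ g (False, p) (False, q) \<le> ennreal (L * sigma (straighten (False, p)) (straighten (False, q)))"
    if "(False, p) \<in> Zset" "(False, q) \<in> Zset" for p q
    using dZ_le_DZ[OF that] DZ_False_le[of p q] sigma_straighten_south(2)[OF L that]
    by (meson ennreal_leI order_trans)
  have nn: "dZ g (True, p) (True, q) \<le> ennreal (L * sigma p q)" if "(True, p) \<in> Zset" "(True, q) \<in> Zset" for p q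
  proof -
    have "p \<in> S2" "q \<in> S2" using that by auto
    then have "DZ g (True, p) (True, q) \<le> ennreal (L * sigma p q)"
      by (simp add: DZ_simps ennreal_leI weak sigma_nonneg)
    then show ?thesis using dZ_le_DZ[OF that] by (rule order_trans[rotated])
  qed
  have sn: "dZ g (False, p) (True, q) \<le> ennreal (L * sigma (straighten (False, p)) q)"
    if p: "(False, p) \<in> Zset" and q: "(True, q) \<in> Zset" for p q
  proof -
    have p': "straighten (False, p) \<in> S2" using p by (rule straighten_in_S2)
    have "straighten (False, p) $ 3 \<le> 0"
    proof -
      obtain a \<phi> where a: "a \<in> S1" "-(pi / 2) \<le> \<phi>" "\<phi> \<le> 0" "straighten (False, p) = lift (g a) \<phi>"
        using p by (rule straighten_south)
      then show ?thesis using sin_ge_zero[of "- \<phi>"] by (simp add: lift_nth_3)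
    qed
    \<comment> \<open>The arc is cut in the target sphere, and the crossing point is pulled back
      through \<open>g\<close> to a point of the seam. Each of the two pieces then costs at most
      \<open>L\<close> times its length.\<close>
    then obtain m where m: "m \<in> S1" "sigma (straighten (False, p)) m + sigma m q = sigma (straighten (False, p)) q"
      using q p' by (auto elim: equator_crossing)
    obtain a where a: "a \<in> S1" "g a = m" using m(1) by (rule g_surjE)
    have mS: "m \<in> S2" "q \<in> S2" using m q S1_subset_S2 by auto
    have "dZ g (False, p) (True, q) \<le> dZ g (False, p) (False, a) + dZ g (False, a) (True, q)"
      using p q S1_in_Zset[OF a(1)] by (intro dZ_triangle)
    also have "\<dots> \<le> ennreal (L * sigma (straighten (False, p)) m) + ennreal (L * sigma m q)"
    proof (rule add_mono)
      show "dZ g (False, p) (False, a) \<le> ennreal (L * sigma (straighten (False, p)) m)"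
        using ss[OF p S1_in_Zset[OF a(1)]] a by (simp add: straighten_S1)
      have "DZ g (False, a) (True, q) \<le> ennreal (L * sigma m q)"
        using a mS by (simp add: DZ_simps ennreal_leI weak sigma_nonneg)
      then show "dZ g (False, a) (True, q) \<le> ennreal (L * sigma m q)"
        using dZ_le_DZ[of "(False, a)" "(True, q)"] a q by (meson S1_in_Zset order_trans)
    qed
    also have "\<dots> = ennreal (L * sigma (straighten (False, p)) q)"
      using L1 mS p' by (simp add: ennreal_plus[symmetric] sigma_nonneg distrib_left[symmetric] m(2) del: ennreal_plus)
    finally show ?thesis .
  qed
  obtain c p where xc: "x = (c, p)" by (cases x)
  obtain c' q where yc: "y = (c', q)" by (cases y)
  show ?thesis
    using x y ss[of p q] nn[of p q] sn[of p q] sn[of q p] dZ_commute[of x y]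
    by (cases c; cases c') (auto simp: xc yc straighten_def sigma_commute)
qed

lemma bilipschitz_sphere:
  assumes L: "bilip sigma S1 sigma L g"
  shows "\<exists>\<Psi>. bij_betw \<Psi> (Ztil g) S2 \<and> bilip (dtil g) (Ztil g) sigma L \<Psi>"
proof -
  have L1: "1 \<le> L" using L by (rule bilip_ge_1)
  have eq_iff: "straighten x = straighten y \<longleftrightarrow> dZ g x y = 0" if x: "x \<in> Zset" and y: "y \<in> Zset" for x y
  proof
    assume "straighten x = straighten y"
    then show "dZ g x y = 0" using dZ_le_sigma_straighten[OF L x y] straighten_in_S2[OF y] by simp
  next
    assume "dZ g x y = 0"
    then have "sigma (straighten x) (straighten y) \<le> 0"
      using sigma_straighten_le_dZ[OF L x y] L1 by (simp add: ennreal_eq_0_iff divide_le_0_iff)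
    then show "straighten x = straighten y"
      using x y by (intro sigma_eq_0D antisym) (auto simp: straighten_in_S2 sigma_nonneg)
  qed
  define \<Psi> where "\<Psi> = (\<lambda>P. straighten (SOME z. z \<in> P))"
  have \<Psi>: "\<Psi> (Qmap g x) = straighten x" if x: "x \<in> Zset" for x
  proof -
    define z where "z = (SOME z. z \<in> Qmap g x)"
    have "z \<in> Qmap g x" unfolding z_def using Qmap_self[OF x] by (rule someI)
    then have "straighten x = straighten z" using eq_iff[OF x, of z] by (simp add: Qmap_def)
    then show ?thesis by (simp add: \<Psi>_def z_def)
  qed
  have "inj_on \<Psi> (Ztil g)"
  proof (rule inj_onI)
    fix P R assume "P \<in> Ztil g" "R \<in> Ztil g" and eq: "\<Psi> P = \<Psi> R"
    then obtain x y where xy: "x \<in> Zset" "y \<in> Zset" "P = Qmap g x" "R = Qmap g y" by (auto simp: Ztil_def)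
    then show "P = R" using eq by (simp add: \<Psi> eq_iff Qmap_eq_iff)
  qed
  moreover have "\<Psi> ` Ztil g = S2"
  proof
    show "\<Psi> ` Ztil g \<subseteq> S2" by (auto simp: Ztil_def \<Psi> straighten_in_S2)
    show "S2 \<subseteq> \<Psi> ` Ztil g"
    proof
      fix q assume "q \<in> S2"
      then obtain z where "z \<in> Zset" "straighten z = q" by (rule straighten_surj)
      then show "q \<in> \<Psi> ` Ztil g" using \<Psi>[of z] by (force simp: Ztil_def)
    qed
  qed
  moreover have "bilip (dtil g) (Ztil g) sigma L \<Psi>"
    unfolding bilip_def
  proof (intro conjI ballI)
    fix P R assume "P \<in> Ztil g" "R \<in> Ztil g"
    then obtain x y where xy: "x \<in> Zset" "y \<in> Zset" "P = Qmap g x" "R = Qmap g y" by (auto simp: Ztil_def)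
    have s: "0 \<le> sigma (straighten x) (straighten y)" using xy by (simp add: sigma_nonneg straighten_in_S2)
    have d: "dZ g x y = ennreal (dtil g P R)" "0 \<le> dtil g P R"
      unfolding xy(3,4) using xy(1,2) by (simp add: ennreal_dtil, simp add: dtil_Qmap)
    show "dtil g P R / L \<le> sigma (\<Psi> P) (\<Psi> R)"
      using dZ_le_sigma_straighten[OF L xy(1,2)] L1 s d xy \<Psi>
      by (simp add: divide_le_eq mult.commute ennreal_le_iff)
    show "sigma (\<Psi> P) (\<Psi> R) \<le> L * dtil g P R"
      using sigma_straighten_le_dZ[OF L xy(1,2)] L1 s d xy \<Psi>
      by (simp add: divide_le_eq mult.commute ennreal_le_iff)
  qed (use L1 in simp)
  ultimately show ?thesis by (auto simp: bij_betw_def)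
qed

end

section \<open>Density at the seam\<close>

text \<open>Cavalieri with horizontal sections; the bound is the area of a triangle of height b - a
  and base 2 M (b - a).\<close>

lemma emeasure_region_ge:
  fixes l u :: "real \<Rightarrow> real"
  assumes T: "T \<in> sets borel" and ab: "a \<le> b" and M: "0 \<le> M"
    and sub: "\<And>h. a \<le> h \<Longrightarrow> h \<le> b \<Longrightarrow> {l h..u h} \<times> {h} \<subseteq> T"
    and len: "\<And>h. a \<le> h \<Longrightarrow> h \<le> b \<Longrightarrow> 2 * M * (b - h) \<le> u h - l h"
  shows "ennreal (M * (b - a)\<^sup>2) \<le> emeasure lborel (T :: (real \<times> real) set)"
proof -
  have T': "T \<in> sets (lborel \<Otimes>\<^sub>M lborel)" using T by (metis lborel_prod sets_lborel)
  have "(\<integral>\<^sup>+h. ennreal (2 * M * (b - h)) * indicator {a..b} h \<partial>lborel)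
      = ennreal (- (M * (b - b)\<^sup>2) - - (M * (b - a)\<^sup>2))"
  proof (rule nn_integral_FTC_Icc[OF _ _ _ ab])
    fix h assume "h \<in> {a..b}"
    then have h: "a \<le> h" "h \<le> b" by auto
    show "((\<lambda>h. - (M * (b - h)\<^sup>2)) has_real_derivative 2 * M * (b - h)) (at h)"
      by (auto intro!: derivative_eq_intros simp: algebra_simps)
    show "0 \<le> 2 * M * (b - h)" using h M by simp
  qed auto
  then have "ennreal (M * (b - a)\<^sup>2) = (\<integral>\<^sup>+h. ennreal (2 * M * (b - h)) * indicator {a..b} h \<partial>lborel)"
    by simp
  also have "\<dots> \<le> (\<integral>\<^sup>+h. emeasure lborel ((\<lambda>x. (x, h)) -` T) \<partial>lborel)"
  proof (rule nn_integral_mono)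
    fix h
    show "ennreal (2 * M * (b - h)) * indicator {a..b} h \<le> emeasure lborel ((\<lambda>x. (x, h)) -` T)"
    proof (cases "h \<in> {a..b}")
      case True
      then have h: "a \<le> h" "h \<le> b" by auto
      have "0 \<le> 2 * M * (b - h)" using h M by simp
      then have "ennreal (2 * M * (b - h)) \<le> emeasure lborel {l h..u h}"
        using len[OF h] by (simp add: ennreal_leI)
      also have "\<dots> \<le> emeasure lborel ((\<lambda>x. (x, h)) -` T)"
      proof (rule emeasure_mono)
        show "{l h..u h} \<subseteq> (\<lambda>x. (x, h)) -` T" using sub[OF h] by auto
        have "(\<lambda>x. (x, h)) \<in> borel_measurable borel"
          by (intro borel_measurable_continuous_onI continuous_intros)
        from measurable_sets[OF this T] show "(\<lambda>x. (x, h)) -` T \<in> sets lborel" by simp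
      qed
      finally show ?thesis using True by simp
    qed simp
  qed
  also have "\<dots> = emeasure lborel T"
    unfolding lborel_prod[symmetric] by (rule lborel_pair.emeasure_pair_measure_alt2[OF T', symmetric])
  finally show ?thesis .
qed

context gluing
begin

text \<open>Coordinates (longitude, height over the equator), with positive height in both
  hemispheres, so that one estimate serves both. Northern longitudes are taken after gluing: if
  \<open>G\<close> is a lift of \<open>g\<close>, then \<open>hemi True (G v, h)\<close> lies over
  the seam point of parameter \<open>v\<close>.\<close>

definition hemi :: "bool \<Rightarrow> real \<times> real \<Rightarrow> bool \<times> (real^3)" where
  "hemi b z = (b, lift (circ (fst z)) (if b then snd z else - snd z))"

lemma hemi_in_Zset:
  assumes "0 < snd z" "snd z < pi / 2" shows "hemi b z \<in> Zset"
proof -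
  have "0 < sin (snd z)" using assms by (intro sin_gt_zero) auto
  then show ?thesis by (cases b) (auto simp: hemi_def lift_nth_3)
qed

text \<open>The assumption \<open>d\<close> excludes the entry h + h' of the minimum in
  \<open>dZ_ge_min\<close>, which accounts for chains through the seam. What remains is the
  spherical distance, which \<open>chart_lower\<close> compares with the plane.\<close>

lemma dZ_hemi_ge:
  assumes h: "0 < h" "h \<le> w" "0 < h'" "h' \<le> w" and w: "w < pi / 2" and u: "\<bar>u - u'\<bar> \<le> 2 * w"
    and d: "dtil g (Qmap g (hemi b (u, h))) (Qmap g (hemi b (u', h'))) < h + h'"
  shows "(cos w)\<^sup>2 * dist (u, h) (u', h') \<le> dtil g (Qmap g (hemi b (u, h))) (Qmap g (hemi b (u', h')))"
    (is "_ \<le> ?d")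
proof -
  define \<epsilon> :: real where "\<epsilon> = (if b then 1 else -1)"
  define p where "p = lift (circ u) (\<epsilon> * h)"
  define q where "q = lift (circ u') (\<epsilon> * h')"
  have \<epsilon>: "\<bar>\<epsilon>\<bar> = 1" by (simp add: \<epsilon>_def)
  have hemi: "hemi b (u, h) = (b, p)" "hemi b (u', h') = (b, q)"
    by (auto simp: hemi_def p_def q_def \<epsilon>_def)
  have Z: "(b, p) \<in> Zset" "(b, q) \<in> Zset"
    using hemi_in_Zset[of "(u, h)" b] hemi_in_Zset[of "(u', h')" b] h w by (auto simp: hemi)
  have "lat p = \<epsilon> * h" "lat q = \<epsilon> * h'"
    unfolding p_def q_def using h w by (auto intro!: lat_lift simp: \<epsilon>_def)
  then have lat: "\<bar>lat p\<bar> + \<bar>lat q\<bar> = h + h'" using h \<epsilon> by (simp add: abs_mult)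
  have "ennreal (min (sigma p q) (h + h')) \<le> ennreal ?d"
    using dZ_ge_min[OF Z] ennreal_dtil[OF Z] by (simp add: lat hemi)
  moreover have "0 \<le> ?d" by (simp add: hemi dtil_Qmap[OF Z])
  ultimately have "sigma p q \<le> ?d" using d by (simp add: min_def split: if_splits)
  moreover have "(cos w)\<^sup>2 * dist (u, \<epsilon> * h) (u', \<epsilon> * h') \<le> sigma p q"
    unfolding p_def q_def using h w u \<epsilon> by (intro chart_lower) (auto simp: abs_mult)
  moreover have "dist (u, \<epsilon> * h) (u', \<epsilon> * h') = dist (u, h) (u', h')"
    using \<epsilon> by (simp add: dist_prod_def dist_real_def abs_mult flip: right_diff_distrib)
  ultimately show ?thesis by simp
qed

text \<open>\<open>H\<close> stands for the lift of \<open>g\<close> in the northern hemisphere and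
  for the inverse of the lift in the southern one; \<tau> is the parameter in the domain of
  \<open>H\<close> that belongs to \<open>y0\<close>. Assumption \<open>near\<close> records the
  cost of moving along the seam and then along a meridian.\<close>

lemma density_lower_bound:
  fixes H :: "real \<Rightarrow> real"
  assumes cont: "continuous_on UNIV H" and mono: "strict_mono H" and M: "0 < M" and s0: "0 < s0"
    and incr: "\<And>s. 0 < s \<Longrightarrow> s < s0 \<Longrightarrow> 2 * M * s \<le> H (\<tau> + s) - H (\<tau> - s)"
    and y0: "y0 \<in> Zset"
    and near: "\<And>v h. 0 < h \<Longrightarrow> h < pi / 2 \<Longrightarrow> dZ g y0 (hemi b (H v, h)) \<le> ennreal (\<bar>v - \<tau>\<bar> + h)"
  shows "ennreal (M / pi) \<le> Liminf (at_right 0)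
    (\<lambda>r::real. hausdorff2 (dtil g) (Ztil g) (cball_til g (Qmap g y0) r) / ennreal (pi * r\<^sup>2))"
    (is "_ \<le> Liminf _ ?f")
proof -
  have main: "ennreal (\<rho> * (M / pi)) \<le> Liminf (at_right 0) ?f" if \<rho>: "0 < \<rho>" "\<rho> < 1" for \<rho>
  proof -
    \<comment> \<open>\<open>w\<close> collects all losses: the factor (cos w)^2 of the flat
      coordinates, squared for area, and (1 - w)^2 from discarding the heights below w r.\<close>
    have "((\<lambda>w::real. (cos w)^4 * (1 - w)\<^sup>2) \<longlongrightarrow> (cos 0)^4 * (1 - 0)\<^sup>2) (at_right 0)"
      by (intro tendsto_intros)
    then have "eventually (\<lambda>w::real. \<rho> < (cos w)^4 * (1 - w)\<^sup>2) (at_right 0)"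
      using \<rho> by (intro order_tendstoD) auto
    moreover have "eventually (\<lambda>w::real. w \<in> {0<..<1}) (at_right 0)"
      by (rule eventually_at_rightI[of 0 1]) auto
    ultimately have "eventually (\<lambda>w::real. \<rho> < (cos w)^4 * (1 - w)\<^sup>2 \<and> w \<in> {0<..<1}) (at_right 0)"
      by (rule eventually_conj)
    then obtain w :: real where w: "\<rho> < (cos w)^4 * (1 - w)\<^sup>2" "0 < w" "w < 1"
      using eventually_happens'[OF trivial_limit_at_right_real] by (auto simp: trivial_limit_def)
    have wpi: "w < pi / 2" using w pi_gt3 by simp
    have cw: "0 < cos w" using w wpi by (intro cos_gt_zero) auto
    have "isCont H \<tau>" using cont by (simp add: continuous_on_eq_continuous_at)
    then obtain \<eta> where \<eta>: "0 < \<eta>" "\<And>u. \<bar>u - \<tau>\<bar> < \<eta> \<Longrightarrow> \<bar>H u - H \<tau>\<bar> < w"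
      using w unfolding continuous_at_eps_delta dist_real_def by blast
    \<comment> \<open>Below \<open>s0\<close> the increments are controlled, below \<eta> the
      longitudes in \<open>T\<close> stay within \<open>w\<close> of \<open>H \<tau>\<close>, and
      below \<open>w\<close> the heights are at most \<open>w\<close>; together this makes
      \<open>dZ_hemi_ge\<close> applicable to any two points of \<open>T\<close>.\<close>
    define r0 where "r0 = min (min s0 \<eta>) w"
    have r0: "0 < r0" using s0 \<eta> w by (simp add: r0_def)
    have "eventually (\<lambda>r. ennreal (\<rho> * (M / pi)) \<le> ?f r) (at_right 0)"
    proof (rule eventually_at_rightI[OF _ r0])
      fix r assume "r \<in> {0<..<r0}"
      then have r: "0 < r" "r < s0" "r < \<eta>" "r < w" by (auto simp: r0_def)
      define T where "T = {z :: real \<times> real. w * r \<le> snd z \<and> snd z \<le> r \<and>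
        H (\<tau> - (r - snd z)) \<le> fst z \<and> fst z \<le> H (\<tau> + (r - snd z))}"
      define E where "E = (\<lambda>z. Qmap g (hemi b z))"
      have wr: "0 < w * r" "w * r < r" using w r by auto
      have "closed T"
        unfolding T_def
        by (intro closed_Collect_conj closed_Collect_le continuous_intros continuous_on_compose2[OF cont]) auto
      then have T: "T \<in> sets borel" by simp
      have Tz: "hemi b z \<in> Zset \<and> 0 < snd z \<and> snd z \<le> w \<and> \<bar>fst z - H \<tau>\<bar> \<le> w" if z: "z \<in> T" for z
      proof -
        have h: "0 < snd z" "snd z \<le> r" using z wr by (auto simp: T_def)
        have "\<bar>H (\<tau> - (r - snd z)) - H \<tau>\<bar> < w" "\<bar>H (\<tau> + (r - snd z)) - H \<tau>\<bar> < w"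
          using h r by (auto intro!: \<eta>(2))
        then show ?thesis using h r w wpi z hemi_in_Zset[of z b] by (auto simp: T_def)
      qed
      have sub: "E ` T \<subseteq> cball_til g (Qmap g y0) r"
      proof
        fix P assume "P \<in> E ` T"
        then obtain z where z: "z \<in> T" "P = Qmap g (hemi b z)" by (auto simp: E_def)
        have zt: "w * r \<le> snd z" "snd z \<le> r" "H (\<tau> - (r - snd z)) \<le> fst z" "fst z \<le> H (\<tau> + (r - snd z))"
          using z(1) by (auto simp: T_def)
        then obtain v where v: "\<tau> - (r - snd z) \<le> v" "v \<le> \<tau> + (r - snd z)" "H v = fst z"
          using IVT'[of H "\<tau> - (r - snd z)" "fst z" "\<tau> + (r - snd z)"] continuous_on_subset[OF cont] by auto
        have "dZ g y0 (hemi b (H v, snd z)) \<le> ennreal (\<bar>v - \<tau>\<bar> + snd z)"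
          by (rule near) (use zt wr r w wpi in linarith)+
        then have "dZ g y0 (hemi b z) \<le> ennreal (\<bar>v - \<tau>\<bar> + snd z)" by (simp only: v(3) prod.collapse)
        also have "\<dots> \<le> ennreal r" using v by (intro ennreal_leI) auto
        finally have "ennreal (dtil g (Qmap g y0) P) \<le> ennreal r"
          using Tz[OF z(1)] y0 by (simp add: z(2) ennreal_dtil)
        then have "dtil g (Qmap g y0) P \<le> r" using r by simp
        then show "P \<in> cball_til g (Qmap g y0) r" using Tz[OF z(1)] by (auto simp: cball_til_def Ztil_def z(2))
      qed
      have "ennreal (M * (r - w * r)\<^sup>2) \<le> emeasure lborel T"
      proof (rule emeasure_region_ge[OF T, where l = "\<lambda>h. H (\<tau> - (r - h))" and u = "\<lambda>h. H (\<tau> + (r - h))"])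
        fix h assume h: "w * r \<le> h" "h \<le> r"
        then show "{H (\<tau> - (r - h))..H (\<tau> + (r - h))} \<times> {h} \<subseteq> T" by (auto simp: T_def)
        show "2 * M * (r - h) \<le> H (\<tau> + (r - h)) - H (\<tau> - (r - h))"
        proof (cases "h = r")
          case False
          then show ?thesis by (intro incr) (use h wr r in linarith)+
        qed simp
      qed (use w wr M in auto)
      then have "ennreal (((cos w)\<^sup>2)\<^sup>2) * ennreal (M * (r - w * r)\<^sup>2) \<le> ennreal (((cos w)\<^sup>2)\<^sup>2) * emeasure lborel T"
        by (intro mult_left_mono) auto
      also have "\<dots> \<le> hausdorff2 (dtil g) (Ztil g) (cball_til g (Qmap g y0) r)"
      proof (rule hausdorff2_ge_area[OF T sub _ wr(1)])
        fix p q assume p: "p \<in> T" and q: "q \<in> T" and d: "dtil g (E p) (E q) \<le> w * r"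
        \<comment> \<open>The heights add up to at least 2 w r, which exceeds the mesh w r, so a
          distance this small cannot come from a passage through the seam.\<close>
        have "w * r \<le> snd p" "w * r \<le> snd q" using p q by (auto simp: T_def)
        then have "dtil g (E p) (E q) < snd p + snd q" using d wr by simp
        then show "(cos w)\<^sup>2 * dist p q \<le> dtil g (E p) (E q)"
          using dZ_hemi_ge[of "snd p" w "snd q" "fst p" "fst q" b] Tz[OF p] Tz[OF q] wpi
          by (simp add: E_def) argo
      qed (use cw in simp)
      finally have "ennreal (((cos w)\<^sup>2)\<^sup>2 * (M * (r - w * r)\<^sup>2)) \<le> hausdorff2 (dtil g) (Ztil g) (cball_til g (Qmap g y0) r)"
        using M by (simp add: ennreal_mult)
      moreover have "\<rho> * M * r\<^sup>2 \<le> ((cos w)\<^sup>2)\<^sup>2 * (M * (r - w * r)\<^sup>2)"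
      proof -
        have "((cos w)\<^sup>2)\<^sup>2 * (M * (r - w * r)\<^sup>2) = ((cos w)^4 * (1 - w)\<^sup>2) * (M * r\<^sup>2)"
          by (simp add: power2_eq_square power4_eq_xxxx algebra_simps)
        moreover have "\<rho> * (M * r\<^sup>2) \<le> ((cos w)^4 * (1 - w)\<^sup>2) * (M * r\<^sup>2)"
          using w M by (intro mult_right_mono) auto
        ultimately show ?thesis by (simp only: mult.assoc)
      qed
      ultimately have "ennreal (\<rho> * M * r\<^sup>2) \<le> hausdorff2 (dtil g) (Ztil g) (cball_til g (Qmap g y0) r)"
        by (meson ennreal_leI order_trans)
      then have "ennreal (\<rho> * M * r\<^sup>2) / ennreal (pi * r\<^sup>2) \<le> ?f r"
        by (rule divide_right_mono_ennreal)
      moreover have "ennreal (\<rho> * M * r\<^sup>2) / ennreal (pi * r\<^sup>2) = ennreal (\<rho> * (M / pi))"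
        using \<rho> M r by (subst divide_ennreal) (auto simp: field_simps)
      ultimately show "ennreal (\<rho> * (M / pi)) \<le> ?f r" by simp
    qed
    then show ?thesis by (rule Liminf_bounded)
  qed
  show ?thesis
  proof (cases "Liminf (at_right 0) ?f")
    case (real c)
    have "M / pi \<le> c"
      by (rule field_le_mult_one_interval) (use main real M in \<open>auto simp: ennreal_le_iff\<close>)
    then show ?thesis using real by (simp add: ennreal_leI)
  qed simp
qed

text \<open>The exponent 4 is two plus two. The ball of radius r lands in a cap of radius L r, which
  projects into a disc of area L^2 times pi r^2; returning by the inverse of \<Psi> costs another
  factor L^2. The distortion \<open>K\<close> of the projection tends to 1 as r -> 0.\<close>

lemma density_upper_bound:
  assumes \<Psi>: "bilip (dtil g) (Ztil g) sigma L \<Psi>" and im: "\<Psi> ` Ztil g \<subseteq> S2" and y: "y \<in> Ztil g"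
  shows "Liminf (at_right 0)
    (\<lambda>r::real. hausdorff2 (dtil g) (Ztil g) (cball_til g y r) / ennreal (pi * r\<^sup>2)) \<le> ennreal (L ^ 4)"
    (is "Liminf _ ?f \<le> _")
proof -
  have L: "0 < L" using \<Psi> by (simp add: bilip_def)
  have le: "dtil g P R \<le> L * sigma (\<Psi> P) (\<Psi> R)" "sigma (\<Psi> P) (\<Psi> R) \<le> L * dtil g P R"
    if "P \<in> Ztil g" "R \<in> Ztil g" for P R
    using \<Psi> that L by (auto simp: bilip_def field_simps)
  have yS: "\<Psi> y \<in> S2" using im y by auto
  obtain f :: "real^3 \<Rightarrow> real \<times> real" where
    f: "\<And>p R. p \<in> S2 \<Longrightarrow> sigma (\<Psi> y) p \<le> R \<Longrightarrow> norm (f p) \<le> R"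
      "\<And>p q R. p \<in> S2 \<Longrightarrow> q \<in> S2 \<Longrightarrow> sigma (\<Psi> y) p \<le> R \<Longrightarrow> sigma (\<Psi> y) q \<le> R \<Longrightarrow> R < 1
        \<Longrightarrow> sigma p q \<le> 1 / (sqrt (1 - R\<^sup>2) * cos R) * dist (f p) (f q)"
    by (rule cap_projection[OF yS]) (rule that)
  define K where "K = (\<lambda>R::real. 1 / (sqrt (1 - R\<^sup>2) * cos R))"
  have bound: "?f r \<le> ennreal (L^4 * (K (L * r))\<^sup>2)" if r: "0 < r" "r < 1 / L" for r
  proof -
    define R where "R = L * r"
    have R: "0 < R" "R < 1" using r L by (auto simp: R_def field_simps)
    have "R\<^sup>2 < 1" using R by (simp add: abs_square_less_1)
    moreover have "0 < cos R" using R pi_gt3 by (intro cos_gt_zero) auto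
    ultimately have K: "0 < K R" by (simp add: K_def)
    have B: "z \<in> Ztil g \<and> \<Psi> z \<in> S2 \<and> sigma (\<Psi> y) (\<Psi> z) \<le> R" if "z \<in> cball_til g y r" for z
    proof -
      have z: "z \<in> Ztil g" "dtil g y z \<le> r" using that by (auto simp: cball_til_def)
      have "sigma (\<Psi> y) (\<Psi> z) \<le> L * dtil g y z" using le(2)[OF y z(1)] .
      also have "\<dots> \<le> R" unfolding R_def using z L by (intro mult_left_mono) auto
      finally show ?thesis using z im by auto
    qed
    have "hausdorff2 (dtil g) (Ztil g) (cball_til g y r) \<le> ennreal ((L * K R)\<^sup>2 * (pi * R\<^sup>2))"
    proof (rule hausdorff2_le_disc[where f = "\<lambda>z. f (\<Psi> z)"])
      show "cball_til g y r \<subseteq> Ztil g" by (auto simp: cball_til_def)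
      show "(\<lambda>z. f (\<Psi> z)) ` cball_til g y r \<subseteq> cball 0 R" using f(1) B R by auto
      fix u v assume u: "u \<in> cball_til g y r" and v: "v \<in> cball_til g y r"
      have "dtil g u v \<le> L * sigma (\<Psi> u) (\<Psi> v)" using le(1) B[OF u] B[OF v] by simp
      also have "\<dots> \<le> L * (K R * dist (f (\<Psi> u)) (f (\<Psi> v)))"
        unfolding K_def using f(2) B[OF u] B[OF v] R L by (intro mult_left_mono) auto
      finally show "dtil g u v \<le> L * K R * dist (f (\<Psi> u)) (f (\<Psi> v))" by (simp add: mult.assoc)
    qed (use K L R in auto)
    then have "?f r \<le> ennreal ((L * K R)\<^sup>2 * (pi * R\<^sup>2)) / ennreal (pi * r\<^sup>2)"
      by (rule divide_right_mono_ennreal)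
    also have "\<dots> = ennreal ((L * K R)\<^sup>2 * (pi * R\<^sup>2) / (pi * r\<^sup>2))"
      using r by (intro divide_ennreal) auto
    also have "(L * K R)\<^sup>2 * (pi * R\<^sup>2) / (pi * r\<^sup>2) = L^4 * (K R)\<^sup>2"
      using r by (simp add: R_def field_simps power4_eq_xxxx power2_eq_square)
    finally show ?thesis by (simp add: R_def)
  qed
  have "eventually (\<lambda>r. ?f r \<le> ennreal (L^4 * (K (L * r))\<^sup>2)) (at_right 0)"
    by (rule eventually_at_rightI[of 0 "1 / L"]) (use bound L in auto)
  then have "Liminf (at_right 0) ?f \<le> Liminf (at_right 0) (\<lambda>r. ennreal (L^4 * (K (L * r))\<^sup>2))"
    by (rule Liminf_mono)
  also have "((\<lambda>r. ennreal (L^4 * (K (L * r))\<^sup>2)) \<longlongrightarrow> ennreal (L^4 * (1 / (sqrt (1 - (L * 0)\<^sup>2) * cos (L * 0)))\<^sup>2)) (at_right 0)"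
    unfolding K_def by (intro tendsto_intros) auto
  then have "Liminf (at_right 0) (\<lambda>r. ennreal (L^4 * (K (L * r))\<^sup>2)) = ennreal (L^4)"
    by (intro lim_imp_Liminf) (auto simp: trivial_limit_at_right_real)
  finally show ?thesis .
qed

end

section \<open>The lift of the gluing map to the line, and its Lipschitz bounds\<close>

text \<open>As \<open>circ\<close> has period 2 pi, G (t + 2 pi) - G t is a multiple of 2 pi,
  positive by monotonicity and hence at least 2 pi. So \<open>G\<close> is unbounded in both
  directions, and the intermediate value theorem applies.\<close>

lemma surj_circ_lift:
  fixes G :: "real \<Rightarrow> real"
  assumes cont: "continuous_on UNIV G" and mono: "strict_mono G" and G: "\<And>t. g (circ t) = circ (G t)"
  shows "surj G"
proof -
  have step: "G t + 2 * pi \<le> G (t + 2 * pi)" for t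
  proof -
    have "circ (G (t + 2 * pi)) = circ (G t)" by (simp flip: G) (simp add: circ_def)
    then obtain n :: int where n: "G (t + 2 * pi) = G t + 2 * pi * of_int n"
      using sin_cos_eq_iff[of "G (t + 2 * pi)" "G t"] by (auto simp: circ_eq_iff)
    have "G t < G (t + 2 * pi)" using strict_monoD[OF mono, of t "t + 2 * pi"] by simp
    then have "0 < of_int n * (2 * pi)" using n by (simp add: mult.commute)
    then have "1 \<le> n" by (simp add: zero_less_mult_iff)
    then have "2 * pi * 1 \<le> 2 * pi * real_of_int n" by (intro mult_left_mono) auto
    then show ?thesis using n by simp
  qed
  have up: "G 0 + 2 * pi * real n \<le> G (2 * pi * real n)" for n
  proof (induction n)
    case (Suc n)
    then show ?case using step[of "2 * pi * real n"] by (simp add: algebra_simps)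
  qed simp
  have down: "G (- (2 * pi * real n)) \<le> G 0 - 2 * pi * real n" for n
  proof (induction n)
    case (Suc n)
    have "- (2 * pi * real (Suc n)) + 2 * pi = - (2 * pi * real n)" by (simp add: algebra_simps)
    then show ?case using Suc step[of "- (2 * pi * real (Suc n))"] by (simp add: algebra_simps)
  qed simp
  have "\<exists>t. G t = y" for y
  proof -
    obtain n where n: "\<bar>y - G 0\<bar> / (2 * pi) \<le> real n" using real_arch_simple by blast
    then have "\<bar>y - G 0\<bar> \<le> 2 * pi * real n" by (simp add: field_simps)
    then have "G (- (2 * pi * real n)) \<le> y" "y \<le> G (2 * pi * real n)" using up[of n] down[of n] by auto
    then show ?thesis
      using IVT'[of G "- (2 * pi * real n)" y "2 * pi * real n"] continuous_on_subset[OF cont] by auto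
  qed
  then show ?thesis by (metis surjI surj_def)
qed

locale oriented_gluing = gluing +
  fixes G :: "real \<Rightarrow> real"
  assumes G_cont: "continuous_on UNIV G" and G_mono: "strict_mono G"
    and g_circ: "\<And>t. g (circ t) = circ (G t)"
begin

definition G' :: "real \<Rightarrow> real" where "G' = inv G"

lemma G_G' [simp]: "G (G' u) = u"
  using surj_circ_lift[OF G_cont G_mono g_circ] by (simp add: G'_def surj_f_inv_f)

lemma G'_G [simp]: "G' (G t) = t"
  using strict_mono_imp_inj_on[OF G_mono] by (simp add: G'_def)

lemma G'_mono: "strict_mono G'"
  by (rule strict_monoI) (metis G_G' G_mono strict_mono_less)

lemma G'_cont: "continuous_on UNIV G'"
proof -
  have "isCont G' (G t)" for t
    by (rule isCont_inverse_function[of 1]) (use G_cont in \<open>auto simp: continuous_on_eq_continuous_at\<close>)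
  then have "isCont G' u" for u by (metis G_G')
  then show ?thesis by (simp add: continuous_on_eq_continuous_at)
qed

lemma circ_in_Zset: "(False, circ t) \<in> Zset"
  by simp

lemma DZ_circ_le:
  "DZ g (False, circ s) (False, circ t) \<le> ennreal \<bar>s - t\<bar>"
  "DZ g (False, circ s) (False, circ t) \<le> ennreal \<bar>G s - G t\<bar>"
proof -
  show "DZ g (False, circ s) (False, circ t) \<le> ennreal \<bar>s - t\<bar>"
    using DZ_False_le[of "circ s" "circ t"] sigma_circ_le[of s t] by (meson ennreal_leI order_trans)
  have "DZ g (False, circ s) (False, circ t) \<le> ennreal (sigma (circ (G s)) (circ (G t)))"
    by (simp add: DZ_simps g_circ ennreal_leI)
  then show "DZ g (False, circ s) (False, circ t) \<le> ennreal \<bar>G s - G t\<bar>"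
    using sigma_circ_le[of "G s" "G t"] by (meson ennreal_leI order_trans)
qed

lemma dZ_via_seam:
  assumes z: "z \<in> Zset" and s: "DZ g (False, circ s) (False, circ t) \<le> ennreal e"
    and h: "DZ g (False, circ t) z \<le> ennreal h" and "0 \<le> e" "0 \<le> h"
  shows "dZ g (False, circ s) z \<le> ennreal (e + h)"
proof -
  have "dZ g (False, circ s) z \<le> DZ g (False, circ s) (False, circ t) + DZ g (False, circ t) z"
    using dZ_triangle[OF circ_in_Zset circ_in_Zset z, of s t]
      dZ_le_DZ[OF circ_in_Zset circ_in_Zset, of s t] dZ_le_DZ[OF circ_in_Zset z, of t]
    by (meson add_mono order_trans)
  also have "\<dots> \<le> ennreal e + ennreal h" using s h by (rule add_mono)
  finally show ?thesis using assms by simp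
qed

lemma dZ_north:
  assumes h: "0 < h" "h < pi / 2"
  shows "dZ g (False, circ t) (hemi True (G v, h)) \<le> ennreal (\<bar>v - t\<bar> + h)"
proof (rule dZ_via_seam)
  show "DZ g (False, circ t) (False, circ v) \<le> ennreal \<bar>v - t\<bar>"
    using DZ_circ_le(1)[of t v] by (simp add: abs_minus_commute)
  show "DZ g (False, circ v) (hemi True (G v, h)) \<le> ennreal h"
    using sigma_lift_same[of "circ (G v)" 0 h] h pi_gt_zero by (simp add: hemi_def DZ_simps g_circ)
qed (use h hemi_in_Zset in auto)

text \<open>Movement along the seam is priced here by the parameter after \<open>g\<close>, whereas
  \<open>dZ_north\<close> prices it before \<open>g\<close>; the minimum in \<open>DZ\<close> allows
  both. The point lies over the seam parameter \<open>G' v\<close>, at which \<open>G\<close> takes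
  the value \<open>v\<close>.\<close>

lemma dZ_south:
  assumes h: "0 < h" "h < pi / 2"
  shows "dZ g (False, circ t) (hemi False (G' v, h)) \<le> ennreal (\<bar>v - G t\<bar> + h)"
proof (rule dZ_via_seam)
  show "DZ g (False, circ t) (False, circ (G' v)) \<le> ennreal \<bar>v - G t\<bar>"
    using DZ_circ_le(2)[of t "G' v"] by (simp add: abs_minus_commute)
  have "DZ g (False, circ (G' v)) (hemi False (G' v, h)) \<le> ennreal (sigma (circ (G' v)) (lift (circ (G' v)) (- h)))"
    unfolding hemi_def by (simp add: DZ_False_le)
  then show "DZ g (False, circ (G' v)) (hemi False (G' v, h)) \<le> ennreal h"
    using sigma_lift_same[of "circ (G' v)" 0 "- h"] h pi_gt_zero by simp
qed (use h hemi_in_Zset in auto)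

lemma bilip_of_density_bound:
  assumes C: "0 \<le> C" and dens: "\<And>y. y \<in> Qmap g ` seam \<Longrightarrow> Liminf (at_right 0)
    (\<lambda>r::real. hausdorff2 (dtil g) (Ztil g) (cball_til g y r) / ennreal (pi * r\<^sup>2)) \<le> ennreal C"
  shows "bilip sigma S1 sigma (pi * C) g"
proof -
  have dens': "Liminf (at_right 0)
    (\<lambda>r::real. hausdorff2 (dtil g) (Ztil g) (cball_til g (Qmap g (False, circ t)) r) / ennreal (pi * r\<^sup>2)) \<le> ennreal C" for t
    by (rule dens) (simp add: seam_def iota1_def)
  \<comment> \<open>\<open>near\<close> asks only for some seam parameter t, since the one that
    belongs to \<tau> is \<tau> itself when \<open>H\<close> is \<open>G\<close>, and
    \<open>G' \<tau>\<close> when \<open>H\<close> is \<open>G'\<close>.\<close>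
  have increment: "H b - H a \<le> pi * C * (b - a)"
    if H: "continuous_on UNIV H" "strict_mono H" and ab: "a \<le> b"
      and near: "\<And>\<tau>. \<exists>t. \<forall>v h. 0 < h \<longrightarrow> h < pi / 2 \<longrightarrow> dZ g (False, circ t) (hemi c (H v, h)) \<le> ennreal (\<bar>v - \<tau>\<bar> + h)"
    for H a b c
  proof -
    \<comment> \<open>The estimate is proved for every \<open>M\<close> above pi C, because the
      density bound contradicts only a strict excess; then \<open>M\<close> decreases to pi
      C.\<close>
    have M: "H b - H a \<le> M * (b - a)" if M: "pi * C < M" for M
    proof (rule increment_le_of_fine_increments[OF H _ ab])
      have "0 \<le> pi * C" using C by simp
      then have M0: "0 < M" using M by linarith
      then show "0 \<le> M" by simp
      fix \<tau> \<delta> :: real assume \<delta>: "0 < \<delta>"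
      show "\<exists>s. 0 < s \<and> s < \<delta> \<and> H (\<tau> + s) - H (\<tau> - s) \<le> 2 * M * s"
      proof (rule ccontr)
        assume "\<not> ?thesis"
        then have incr: "2 * M * s \<le> H (\<tau> + s) - H (\<tau> - s)" if "0 < s" "s < \<delta>" for s
          using that by force
        obtain t where t: "\<And>v h. 0 < h \<Longrightarrow> h < pi / 2 \<Longrightarrow> dZ g (False, circ t) (hemi c (H v, h)) \<le> ennreal (\<bar>v - \<tau>\<bar> + h)"
          using near by metis
        have "ennreal (M / pi) \<le> ennreal C"
          using density_lower_bound[OF H M0 \<delta> incr circ_in_Zset t] dens'[of t] by (rule order_trans)
        then have "M / pi \<le> C" using C by simp
        then show False using M by (simp add: field_simps)
      qed
    qed
    show ?thesis
    proof (cases "a = b")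
      case False
      then have ba: "0 < b - a" using ab by simp
      have "(H b - H a) / (b - a) \<le> pi * C"
        by (rule dense_ge) (use M ba in \<open>simp add: field_simps\<close>)
      then show ?thesis using ba by (simp add: field_simps)
    qed simp
  qed
  have G_le: "\<bar>G s - G t\<bar> \<le> pi * C * \<bar>s - t\<bar>" for s t
  proof -
    have "G b - G a \<le> pi * C * (b - a)" if "a \<le> b" for a b
      using that dZ_north by (intro increment[OF G_cont G_mono, of _ _ True]) blast+
    from this[of s t] this[of t s] show ?thesis
      using G_mono by (cases s t rule: linorder_cases) (auto simp: strict_mono_less abs_if)
  qed
  have G'_le: "\<bar>G' s - G' t\<bar> \<le> pi * C * \<bar>s - t\<bar>" for s t
  proof -
    have "\<exists>t. \<forall>v h. 0 < h \<longrightarrow> h < pi / 2 \<longrightarrow> dZ g (False, circ t) (hemi False (G' v, h)) \<le> ennreal (\<bar>v - \<tau>\<bar> + h)" for \<tau>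
      using dZ_south[of _ "G' \<tau>"] by (intro exI[of _ "G' \<tau>"]) auto
    then have "G' b - G' a \<le> pi * C * (b - a)" if "a \<le> b" for a b
      using that by (intro increment[OF G'_cont G'_mono, of _ _ False])
    from this[of s t] this[of t s] show ?thesis
      using G'_mono by (cases s t rule: linorder_cases) (auto simp: strict_mono_less abs_if)
  qed
  \<comment> \<open>\<open>bilip\<close> demands a positive constant, and C = 0 would make
    \<open>G\<close> constant.\<close>
  have C0: "0 < C"
  proof (rule ccontr)
    assume "\<not> 0 < C"
    then have "G 1 = G 0" using G_le[of 1 0] C by simp
    then show False using strict_monoD[OF G_mono, of 0 1] by simp
  qed
  have "sigma (g p) (g q) \<le> pi * C * sigma p q \<and> sigma p q \<le> pi * C * sigma (g p) (g q)"
    if p: "p \<in> S1" and q: "q \<in> S1" for p q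
  proof
    obtain s t where st: "p = circ s" "q = circ t" "\<bar>s - t\<bar> = sigma p q"
      using p q by (rule S1_circ_pairE)
    show "sigma (g p) (g q) \<le> pi * C * sigma p q"
      using sigma_circ_le[of "G s" "G t"] G_le[of s t] st by (simp add: g_circ)
    \<comment> \<open>New parameters are chosen for the image points: \<open>G s\<close> and
      \<open>G t\<close> may differ by more than the distance of \<open>g p\<close> and
      \<open>g q\<close>, while |u - v| equals it.\<close>
    obtain u v where uv: "g p = circ u" "g q = circ v" "\<bar>u - v\<bar> = sigma (g p) (g q)"
      using g_S1[OF p] g_S1[OF q] by (rule S1_circ_pairE)
    have "g (circ (G' u)) = g p" "g (circ (G' v)) = g q" using uv by (simp_all add: g_circ)
    then have "p = circ (G' u)" "q = circ (G' v)"
      using bij_betw_imp_inj_on[OF bij] p q by (auto dest: inj_onD)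
    then show "sigma p q \<le> pi * C * sigma (g p) (g q)"
      using sigma_circ_le[of "G' u" "G' v"] G'_le[of u v] uv by simp
  qed
  then show ?thesis using C0 by (auto simp: bilip_def divide_le_eq mult.commute)
qed

end

theorem theorem1p1:
  fixes g :: "real^3 \<Rightarrow> real^3"
  assumes "orient_pres_homeo g"
  shows "(\<forall>L. bilip sigma S1 sigma L g \<longrightarrow>
            (\<exists>\<Psi>. bij_betw \<Psi> (Ztil g) S2 \<and> bilip (dtil g) (Ztil g) sigma L \<Psi>))
       \<and> (\<forall>L'. (\<exists>\<Psi>. bij_betw \<Psi> (Ztil g) S2 \<and> bilip (dtil g) (Ztil g) sigma L' \<Psi>) \<longrightarrow>
            (\<forall>y \<in> Qmap g ` seam.
               Liminf (at_right 0)
                 (\<lambda>r::real. hausdorff2 (dtil g) (Ztil g) (cball_til g y r) / ennreal (pi * r\<^sup>2))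
               \<le> ennreal (L' ^ 4)))
       \<and> (\<forall>C'\<ge>0. (\<forall>y \<in> Qmap g ` seam.
               Liminf (at_right 0)
                 (\<lambda>r::real. hausdorff2 (dtil g) (Ztil g) (cball_til g y r) / ennreal (pi * r\<^sup>2))
               \<le> ennreal C') \<longrightarrow>
            bilip sigma S1 sigma (pi * C') g)"
proof -
  obtain h G where h: "homeomorphism S1 S1 g h"
    and G: "continuous_on UNIV G" "strict_mono G" "\<And>t. g (circ t) = circ (G t)"
    using assms unfolding orient_pres_homeo_def by blast
  have "bij_betw g S1 S1"
    using h by (auto simp: homeomorphism_def bij_betw_def intro: inj_on_inverseI)
  then interpret oriented_gluing g G using G by unfold_locales
  have seam: "y \<in> Ztil g" if "y \<in> Qmap g ` seam" for y
    using that by (auto simp: Ztil_def seam_def iota1_def simp del: False_in_Zset)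
  show ?thesis
  proof (intro conjI allI impI ballI)
    fix L assume "bilip sigma S1 sigma L g"
    then show "\<exists>\<Psi>. bij_betw \<Psi> (Ztil g) S2 \<and> bilip (dtil g) (Ztil g) sigma L \<Psi>"
      by (rule bilipschitz_sphere)
  next
    fix L' y assume ex: "\<exists>\<Psi>. bij_betw \<Psi> (Ztil g) S2 \<and> bilip (dtil g) (Ztil g) sigma L' \<Psi>"
      and y: "y \<in> Qmap g ` seam"
    then obtain \<Psi> where "bij_betw \<Psi> (Ztil g) S2" "bilip (dtil g) (Ztil g) sigma L' \<Psi>" by blast
    then show "Liminf (at_right 0)
        (\<lambda>r::real. hausdorff2 (dtil g) (Ztil g) (cball_til g y r) / ennreal (pi * r\<^sup>2)) \<le> ennreal (L' ^ 4)"
      using seam[OF y] by (intro density_upper_bound) (auto dest: bij_betw_imp_surj_on)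
  next
    fix C' :: real assume "0 \<le> C'" and dens: "\<forall>y \<in> Qmap g ` seam. Liminf (at_right 0)
        (\<lambda>r::real. hausdorff2 (dtil g) (Ztil g) (cball_til g y r) / ennreal (pi * r\<^sup>2)) \<le> ennreal C'"
    then show "bilip sigma S1 sigma (pi * C') g"
      using bspec[OF dens] by (intro bilip_of_density_bound)
  qed
qed

end
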